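(* Let $d\in\{1,2,3\}$, $\ell=9-d$, and let $K_0(\widetilde w_d)=H_2(\widetilde Y_d,\Sigma;\mathbb{Z})$ with the Seifert pairing and the asymptotic charge $c_{\widetilde w_d}\colon K_0(\widetilde w_d)\to H_1(\Sigma,\mathbb{Z})$ be as in the context, and let $\mathbf p\in K_0(\widetilde w_d)$ be the point-like element. Then: (1) The kernel decomposes as an orthogonal sum $\mathrm{Ker}(c_{\widetilde w_d})=\mathsf E_\ell\oplus\langle\mathbf p\rangle$, where $\mathsf E_\ell$ denotes the $E_\ell$ root lattice. (2) There is a splitting $$K_0(\widetilde w_d)_{\mathbb{Q}}\simeq\mathrm{Ker}((c_{\widetilde w_d})_{\mathbb{Q}})\oplus\mathrm{Im}((c_{\widetilde w_d})_{\mathbb{Q}})$$ which, modulo $\mathbf p$, is orthogonal with respect to the Seifert pairing. That is, for a decomposition $\mathrm{Ker}(c_{\widetilde w_d})=\mathsf E_\ell\oplus\langle\mathbf p\rangle$ as in (1), there is a subspace $V\subset K_0(\widetilde w_d)_{\mathbb{Q}}$, mapped isomorphically onto $\mathrm{Im}((c_{\widetilde w_d})_{\mathbb{Q}})$ by $(c_{\widetilde w_d})_{\mathbb{Q}}$, with $\langle v,e\rangle_{\mathrm{Sft}}=\langle e,v\rangle_{\mathrm{Sft}}=0$ for all $v\in V$ and $e\in(\mathsf E_\ell)_{\mathbb{Q}}$.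
   Context: Fibration. Let $p_1=x^3-\frac13\lambda^4x+\frac{2}{27}\lambda^6-64\lambda^5$, $p_2=x^3+(-\frac13\lambda^4+16\lambda^3)x+\frac{2}{27}\lambda^6-\frac{16}{3}\lambda^5$, $p_3=x^3+(-\frac13\lambda^4+8\lambda^3)x+\frac{2}{27}\lambda^6-\frac83\lambda^5+16\lambda^4$. For fixed $0<|\epsilon|\ll1$, $y^2=p_d(\lambda,x)+\epsilon x$ is a Weierstrass form of a rational minimal elliptic surface over $\mathbb{P}^1$ with $12-d$ fibres of type $I_1$ over $\mathbb{C}$ and one $I_d$ fibre over $\infty$; $\widetilde w_d\colon\widetilde Y_d\to\mathbb{C}$ is its restriction over $\mathbb{C}$, a genus-one Lefschetz fibration, and $\Sigma=\widetilde w_d^{-1}(0)$. Seifert pairing. $H_2(\widetilde Y_d,\Sigma;\mathbb{Z})$ is free on the classes of an ordered system of Lefschetz thimbles $D_0,\dots,D_{\ell+2}$, and $\langle[D_i],[D_j]\rangle_{\mathrm{Sft}}=\langle[\partial D_i],[\partial D_j]\rangle$ for $i<j$, $1$ for $i=j$, $0$ for $i>j$, extended bilinearly. (Explicitly, for suitable thimbles and a basis $a,b$ of $H_1(\Sigma,\mathbb{Z})$ with $\langle a,b\rangle=-1$, the boundary classes are $(a+b,a,b,a,b,a,b,a,b,a,b)$ for $d=1$, $(a+b,a,b,a,a,a-b,b,b,a,b)$ for $d=2$, $(a+b,b,a,b,a,b,a,b,a)$ for $d=3$.) $K_0(\widetilde w_d)$, the Grothendieck group of the derived category of Lagrangian vanishing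 cycles with Euler pairing, is isometric to it. The asymptotic charge $c_{\widetilde w_d}$ sends the class of a thimble $D$ to $[\partial D]\in H_1(\Sigma,\mathbb{Z})$. The subscript $\mathbb{Q}$ denotes extension of scalars to $\mathbb{Q}$. Point-like element. A primitive element $\mathbf p$ of a pseudolattice is point-like if $\langle\mathbf p,\mathbf p\rangle=0$, $\langle\mathbf p,v\rangle=\langle v,\mathbf p\rangle$ for all $v$, and the form is symmetric on $\mathbf p^\perp$. Here $\mathbf p$ is the image of the class of a skyscraper sheaf $[\mathcal{O}_x]$ under an isometry $K_0(X_d)\simeq K_0(\widetilde w_d)$, where $X_d$ is a degree $d$ del Pezzo surface and $K_0(X_d)$ carries the Euler pairing; the isometry matches $c_{\widetilde w_d}$ with restriction to a smooth anticanonical curve. $\mathsf E_\ell$: the $E_\ell$ root lattice, on which the Seifert pairing restricts to the form whose Gram matrix in a root basis is the Cartan matrix of type $E_\ell$; up to sign of the form it is isomorphic to $\mathbf k_\ell^\perp\subset\mathsf I^{1,\ell}$, where $\mathsf I^{1,\ell}=\mathbb{Z}^{\ell+1}$ with form $\mathrm{diag}(1,-1,\dots,-1)$ and $\mathbf k_\ell=(-3,1,\dots,1)$. *)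

theory Defs
  imports "HOL-Analysis.Analysis" "HOL-Algebra.Algebra" "HOL-Homology.Homology"
begin

section \<open>The elliptic fibrations\<close>

text \<open>The cubics are \<open>p\<^sub>d(t, x) = x^3 + A\<^sub>d(t) x + B\<^sub>d(t)\<close>, where \<open>t\<close> is the base coordinate
  (\<open>\<lambda>\<close> is a reserved symbol).\<close>

definition coeff_A :: "nat \<Rightarrow> complex \<Rightarrow> complex" where
  "coeff_A d t =
    (if d = 1 then - (1/3) * t^4
     else if d = 2 then - (1/3) * t^4 + 16 * t^3
     else - (1/3) * t^4 + 8 * t^3)"

definition coeff_B :: "nat \<Rightarrow> complex \<Rightarrow> complex" where
  "coeff_B d t =
    (if d = 1 then (2/27) * t^6 - 64 * t^5
     else if d = 2 then (2/27) * t^6 - (16/3) * t^5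
     else (2/27) * t^6 - (8/3) * t^5 + 16 * t^4)"

definition cubic :: "nat \<Rightarrow> complex \<Rightarrow> complex \<Rightarrow> complex" where
  "cubic d t x = x^3 + coeff_A d t * x + coeff_B d t"

text \<open>Points of the complex projective plane are lines through the origin, given as sets of vectors.\<close>

type_synonym line = "(complex \<times> complex \<times> complex) set"

definition proj_point :: "complex \<times> complex \<times> complex \<Rightarrow> line" where
  "proj_point v = (case v of (x, y, z) \<Rightarrow> range (\<lambda>c. (c * x, c * y, c * z)))"

text \<open>The quotient topology: the generating sets are exactly the sets of lines with open preimage
  in the punctured vector space, and these already form a topology.\<close>

definition CP2 :: "line topology" where
  "CP2 = topology_generated_by
     {U. U \<subseteq> proj_point ` (- {0}) \<and> open {v. v \<noteq> 0 \<and> proj_point v \<in> U}}"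

text \<open>The projective closure, fibrewise over the affine line, of \<open>y^2 = p\<^sub>d(t, x) + \<epsilon> x\<close>.  When all
  singular fibres over the affine line are of type \<open>I\<^sub>1\<close> the Weierstrass model is smooth there, so
  that it is the restriction of the minimal elliptic surface.\<close>

definition total_space :: "nat \<Rightarrow> complex \<Rightarrow> (complex \<times> line) topology" where
  "total_space d \<epsilon> = subtopology (prod_topology euclidean CP2)
     {(t, proj_point (x, y, z)) | t x y z. (x, y, z) \<noteq> 0 \<and>
        y^2 * z = x^3 + (coeff_A d t + \<epsilon>) * x * z^2 + coeff_B d t * z^3}"

definition ref_fibre :: "nat \<Rightarrow> complex \<Rightarrow> (complex \<times> line) set" where
  "ref_fibre d \<epsilon> = {P \<in> topspace (total_space d \<epsilon>). fst P = 0}"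

text \<open>The critical points are the singular points of the fibres, that is the points
  \<open>(x, 0)\<close> with \<open>x\<close> a multiple root of \<open>p\<^sub>d(t, x) + \<epsilon> x\<close>.\<close>

definition crit_points :: "nat \<Rightarrow> complex \<Rightarrow> (complex \<times> line) set" where
  "crit_points d \<epsilon> = {(t, proj_point (x, 0, 1)) | t x.
     cubic d t x + \<epsilon> * x = 0 \<and> deriv (\<lambda>u. cubic d t u + \<epsilon> * u) x = 0}"

definition crit_values :: "nat \<Rightarrow> complex \<Rightarrow> complex set" where
  "crit_values d \<epsilon> = fst ` crit_points d \<epsilon>"

text \<open>The discriminant of \<open>p\<^sub>d(t, x) + \<epsilon> x\<close> has degree \<open>12 - d\<close> in \<open>t\<close>, so having \<open>12 - d\<close> distinct
  critical values means that all its roots are simple, that is all singular fibres over the affine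
  line are of type \<open>I\<^sub>1\<close>.  This holds whenever \<open>0 < \<bar>\<epsilon>\<bar>\<close> is sufficiently small.\<close>

definition generic_perturbation :: "nat \<Rightarrow> complex \<Rightarrow> bool" where
  "generic_perturbation d \<epsilon> \<longleftrightarrow> \<epsilon> \<noteq> 0 \<and> card (crit_values d \<epsilon>) = 12 - d"

section \<open>Homology, asymptotic charge and Lefschetz thimbles\<close>

text \<open>Homology groups are abelian groups written multiplicatively.\<close>

definition K0 :: "nat \<Rightarrow> complex \<Rightarrow> (complex \<times> line) chain set monoid" where
  "K0 d \<epsilon> = relative_homology_group 2 (total_space d \<epsilon>) (ref_fibre d \<epsilon>)"

definition H1 :: "nat \<Rightarrow> complex \<Rightarrow> (complex \<times> line) chain set monoid" where
  "H1 d \<epsilon> = homology_group 1 (subtopology (total_space d \<epsilon>) (ref_fibre d \<epsilon>))"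

text \<open>The class of a thimble is sent to the class of its boundary, so the asymptotic charge is the
  connecting homomorphism of the pair.\<close>

definition charge ::
    "nat \<Rightarrow> complex \<Rightarrow> (complex \<times> line) chain set \<Rightarrow> (complex \<times> line) chain set" where
  "charge d \<epsilon> = hom_boundary 2 (total_space d \<epsilon>) (ref_fibre d \<epsilon>)"

definition vanishing_path :: "nat \<Rightarrow> complex \<Rightarrow> (real \<Rightarrow> complex) \<Rightarrow> bool" where
  "vanishing_path d \<epsilon> \<gamma> \<longleftrightarrow>
     arc \<gamma> \<and> pathstart \<gamma> = 0 \<and> pathfinish \<gamma> \<in> crit_values d \<epsilon> \<and>
     \<gamma> ` {0..<1} \<inter> crit_values d \<epsilon> = {}"

text \<open>A thimble over \<open>\<gamma>\<close> is an embedded disc fibred in circles over \<open>\<gamma>\<close>, with centre the critical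
  point and with boundary in the reference fibre; requiring the boundary to be homologically
  nontrivial forces it to be the vanishing cycle up to sign.  The choice of a generator of
  \<open>H\<^sub>2(D\<^sup>2, S\<^sup>1)\<close> is the choice of an orientation.\<close>

definition thimble_class ::
    "nat \<Rightarrow> complex \<Rightarrow> (real \<Rightarrow> complex) \<Rightarrow> (complex \<times> line) chain set \<Rightarrow> bool" where
  "thimble_class d \<epsilon> \<gamma> \<delta> \<longleftrightarrow>
     (\<exists>h u. embedding_map (top_of_set (cball (0::complex) 1)) (total_space d \<epsilon>) h \<and>
        (\<forall>z\<in>cball 0 1. fst (h z) = \<gamma> (1 - cmod z)) \<and>
        h 0 \<in> crit_points d \<epsilon> \<and>
        u \<in> carrier (relative_homology_group 2 (top_of_set (cball (0::complex) 1)) (sphere 0 1)) \<and>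
        carrier (relative_homology_group 2 (top_of_set (cball (0::complex) 1)) (sphere 0 1)) =
          generate (relative_homology_group 2 (top_of_set (cball (0::complex) 1)) (sphere 0 1)) {u} \<and>
        \<delta> = hom_induced 2 (top_of_set (cball (0::complex) 1)) (sphere 0 1)
              (total_space d \<epsilon>) (ref_fibre d \<epsilon>) h u \<and>
        charge d \<epsilon> \<delta> \<noteq> \<one>\<^bsub>H1 d \<epsilon>\<^esub>)"

text \<open>The paths are disjoint away from the base point, one for each critical value, and ordered by
  their directions at the base point.  Both senses of rotation are allowed, since the orientation
  of the reference fibre is not fixed either.\<close>

definition thimble_system ::
    "nat \<Rightarrow> complex \<Rightarrow> (nat \<Rightarrow> (complex \<times> line) chain set) \<Rightarrow> bool" where
  "thimble_system d \<epsilon> D \<longleftrightarrow>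
     (\<exists>\<gamma> r \<theta>.
        (\<forall>i<12 - d. vanishing_path d \<epsilon> (\<gamma> i) \<and> thimble_class d \<epsilon> (\<gamma> i) (D i)) \<and>
        bij_betw (\<lambda>i. pathfinish (\<gamma> i)) {..<12 - d} (crit_values d \<epsilon>) \<and>
        (\<forall>i<12 - d. \<forall>j<12 - d. i \<noteq> j \<longrightarrow> path_image (\<gamma> i) \<inter> path_image (\<gamma> j) = {0}) \<and>
        (\<forall>i<12 - d. r i > 0 \<and>
           (\<gamma> i has_vector_derivative complex_of_real (r i) * cis (\<theta> i)) (at 0 within {0..1})) \<and>
        (strict_mono_on {..<12 - d} \<theta> \<or> strict_mono_on {..<12 - d} (\<lambda>i. - \<theta> i)) \<and>
        (\<forall>i<12 - d. \<forall>j<12 - d. \<bar>\<theta> i - \<theta> j\<bar> < 2 * pi))"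

text \<open>The coefficients, with respect to \<open>a, b\<close>, of the boundary classes of the thimbles.\<close>

definition boundary_coeffs :: "nat \<Rightarrow> (int \<times> int) list" where
  "boundary_coeffs d =
    (if d = 1 then [(1,1), (1,0), (0,1), (1,0), (0,1), (1,0), (0,1), (1,0), (0,1), (1,0), (0,1)]
     else if d = 2 then [(1,1), (1,0), (0,1), (1,0), (1,0), (1,-1), (0,1), (0,1), (1,0), (0,1)]
     else [(1,1), (0,1), (1,0), (0,1), (1,0), (0,1), (1,0), (0,1), (1,0)])"

section \<open>Free abelian groups with bilinear forms\<close>

definition Z_basis :: "('a, 'm) monoid_scheme \<Rightarrow> 'i set \<Rightarrow> ('i \<Rightarrow> 'a) \<Rightarrow> bool" where
  "Z_basis G I e \<longleftrightarrow> e \<in> I \<rightarrow> carrier G \<and>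
     (\<forall>x\<in>carrier G. \<exists>!m::'i \<Rightarrow> int. m \<in> extensional I \<and> x = (\<Otimes>\<^bsub>G\<^esub>i\<in>I. e i [^]\<^bsub>G\<^esub> m i))"

definition bilinear_form :: "('a, 'm) monoid_scheme \<Rightarrow> ('a \<Rightarrow> 'a \<Rightarrow> int) \<Rightarrow> bool" where
  "bilinear_form G B \<longleftrightarrow>
     (\<forall>x\<in>carrier G. \<forall>y\<in>carrier G. \<forall>z\<in>carrier G.
        B (x \<otimes>\<^bsub>G\<^esub> y) z = B x z + B y z \<and> B z (x \<otimes>\<^bsub>G\<^esub> y) = B z x + B z y)"

text \<open>The intersection pairing is pinned down by its value on a basis \<open>a, b\<close>.\<close>

definition intersection_pairing ::
    "('a, 'm) monoid_scheme \<Rightarrow> 'a \<Rightarrow> 'a \<Rightarrow> ('a \<Rightarrow> 'a \<Rightarrow> int) \<Rightarrow> bool" where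
  "intersection_pairing H a b Q \<longleftrightarrow>
     bilinear_form H Q \<and> (\<forall>x\<in>carrier H. Q x x = 0) \<and> Q a b = - 1"

text \<open>The Seifert pairing of an ordered basis \<open>D\<close> of \<open>G\<close> with charge \<open>c\<close> to a group with pairing \<open>Q\<close>.\<close>

definition seifert_pairing ::
    "('a, 'm) monoid_scheme \<Rightarrow> nat \<Rightarrow> (nat \<Rightarrow> 'a) \<Rightarrow> ('a \<Rightarrow> 'b) \<Rightarrow> ('b \<Rightarrow> 'b \<Rightarrow> int) \<Rightarrow>
       ('a \<Rightarrow> 'a \<Rightarrow> int) \<Rightarrow> bool" where
  "seifert_pairing G n D c Q B \<longleftrightarrow>
     bilinear_form G B \<and>
     (\<forall>i<n. \<forall>j<n. B (D i) (D j) = (if i < j then Q (c (D i)) (c (D j)) else if i = j then 1 else 0))"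

definition primitive :: "('a, 'm) monoid_scheme \<Rightarrow> 'a \<Rightarrow> bool" where
  "primitive G x \<longleftrightarrow> x \<in> carrier G \<and>
     (\<forall>y\<in>carrier G. \<forall>n::int. x = y [^]\<^bsub>G\<^esub> n \<longrightarrow> \<bar>n\<bar> = 1)"

definition point_like :: "('a, 'm) monoid_scheme \<Rightarrow> ('a \<Rightarrow> 'a \<Rightarrow> int) \<Rightarrow> 'a \<Rightarrow> bool" where
  "point_like G B p \<longleftrightarrow> primitive G p \<and> B p p = 0 \<and>
     (\<forall>v\<in>carrier G. B p v = B v p) \<and>
     (\<forall>v\<in>carrier G. \<forall>w\<in>carrier G. B p v = 0 \<longrightarrow> B p w = 0 \<longrightarrow> B v w = B w v)"

text \<open>Bourbaki's labelling of the Dynkin diagram \<open>E\<^sub>l\<close> (\<open>6 \<le> l \<le> 8\<close>): the chain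
  \<open>1 - 3 - 4 - \<dots> - l\<close> with the node \<open>2\<close> attached to \<open>4\<close>.\<close>

definition E_edge :: "nat \<Rightarrow> nat \<Rightarrow> bool" where
  "E_edge i j \<longleftrightarrow> {i, j} = {1, 3} \<or> {i, j} = {2, 4} \<or> (3 \<le> i \<and> j = i + 1) \<or> (3 \<le> j \<and> i = j + 1)"

definition cartan_E :: "nat \<Rightarrow> nat \<Rightarrow> int" where
  "cartan_E i j = (if i = j then 2 else if E_edge i j then - 1 else 0)"

definition E_root_lattice ::
    "('a, 'm) monoid_scheme \<Rightarrow> ('a \<Rightarrow> 'a \<Rightarrow> int) \<Rightarrow> nat \<Rightarrow> 'a set \<Rightarrow> bool" where
  "E_root_lattice G B l E \<longleftrightarrow> subgroup E G \<and>
     (\<exists>e. Z_basis (G\<lparr>carrier := E\<rparr>) {1..l} e \<and>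
          (\<forall>i\<in>{1..l}. \<forall>j\<in>{1..l}. B (e i) (e j) = cartan_E i j))"

definition orthogonal_sum ::
    "('a, 'm) monoid_scheme \<Rightarrow> ('a \<Rightarrow> 'a \<Rightarrow> int) \<Rightarrow> 'a set \<Rightarrow> 'a set \<Rightarrow> 'a set \<Rightarrow> bool" where
  "orthogonal_sum G B N E F \<longleftrightarrow>
     subgroup E G \<and> subgroup F G \<and> N = E <#>\<^bsub>G\<^esub> F \<and> E \<inter> F = {\<one>\<^bsub>G\<^esub>} \<and>
     (\<forall>x\<in>E. \<forall>y\<in>F. B x y = 0 \<and> B y x = 0)"

section \<open>Extension of scalars to the rationals\<close>

text \<open>\<open>(V, \<iota>)\<close> is the localisation of the abelian group \<open>G\<close> at the nonzero integers, that is
  \<open>V = G \<otimes> \<rat>\<close> with \<open>\<iota> x = x \<otimes> 1\<close>; it is unique up to unique isomorphism.  Here \<open>V\<close> is the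
  whole type \<open>'v\<close>.\<close>

definition rat_extension ::
    "('a, 'm) monoid_scheme \<Rightarrow> (rat \<Rightarrow> 'v \<Rightarrow> 'v::ab_group_add) \<Rightarrow> ('a \<Rightarrow> 'v) \<Rightarrow> bool" where
  "rat_extension G sc \<iota> \<longleftrightarrow>
     vector_space sc \<and>
     (\<forall>x\<in>carrier G. \<forall>y\<in>carrier G. \<iota> (x \<otimes>\<^bsub>G\<^esub> y) = \<iota> x + \<iota> y) \<and>
     (\<forall>x\<in>carrier G. \<iota> x = 0 \<longrightarrow> (\<exists>n::nat. n > 0 \<and> x [^]\<^bsub>G\<^esub> n = \<one>\<^bsub>G\<^esub>)) \<and>
     (\<forall>v. \<exists>x\<in>carrier G. \<exists>n::nat. n > 0 \<and> sc (of_nat n) v = \<iota> x)"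

definition extends_hom ::
    "('a, 'm) monoid_scheme \<Rightarrow> (rat \<Rightarrow> 'v \<Rightarrow> 'v::ab_group_add) \<Rightarrow> ('a \<Rightarrow> 'v) \<Rightarrow>
       (rat \<Rightarrow> 'w \<Rightarrow> 'w::ab_group_add) \<Rightarrow> ('b \<Rightarrow> 'w) \<Rightarrow> ('a \<Rightarrow> 'b) \<Rightarrow> ('v \<Rightarrow> 'w) \<Rightarrow> bool" where
  "extends_hom G sc \<iota> sc' \<iota>' f fQ \<longleftrightarrow>
     Vector_Spaces.linear sc sc' fQ \<and> (\<forall>x\<in>carrier G. fQ (\<iota> x) = \<iota>' (f x))"

definition extends_form ::
    "('a, 'm) monoid_scheme \<Rightarrow> (rat \<Rightarrow> 'v \<Rightarrow> 'v::ab_group_add) \<Rightarrow> ('a \<Rightarrow> 'v) \<Rightarrow>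
       ('a \<Rightarrow> 'a \<Rightarrow> int) \<Rightarrow> ('v \<Rightarrow> 'v \<Rightarrow> rat) \<Rightarrow> bool" where
  "extends_form G sc \<iota> B BQ \<longleftrightarrow>
     (\<forall>v. Vector_Spaces.linear sc (*) (BQ v) \<and> Vector_Spaces.linear sc (*) (\<lambda>u. BQ u v)) \<and>
     (\<forall>x\<in>carrier G. \<forall>y\<in>carrier G. BQ (\<iota> x) (\<iota> y) = of_int (B x y))"

definition direct_sum_decomp ::
    "(rat \<Rightarrow> 'v \<Rightarrow> 'v::ab_group_add) \<Rightarrow> 'v set \<Rightarrow> 'v set \<Rightarrow> bool" where
  "direct_sum_decomp sc U V \<longleftrightarrow>
     module.subspace sc U \<and> module.subspace sc V \<and>
     U \<inter> V = {0} \<and> {u + v | u v. u \<in> U \<and> v \<in> V} = UNIV"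

end

theory Submission
  imports Defs
begin

text \<open>
  The boundaries of the thimbles determine both structures on \<open>K\<^sub>0\<close>: the charge is the homomorphism
  with these values on the basis of thimbles, and the Seifert form is upper triangular with the
  intersection numbers of the boundaries above the diagonal.  In particular its antisymmetrisation is
  \<open>\<langle>x, y\<rangle> - \<langle>y, x\<rangle> = c(x) \<cdot> c(y)\<close>.  As the charge is onto and the intersection pairing is unimodular, the classes
  \<open>x\<close> with \<open>\<langle>x, y\<rangle> = \<langle>y, x\<rangle>\<close> for all \<open>y\<close> are exactly those in \<open>Ker c\<close>.

  The heart of the matter is a change of basis.  The group \<open>K\<^sub>0\<close> has a basis consisting of an isotropic
  class \<open>v\<^sub>0\<close>, simple roots \<open>v\<^sub>1, \<dots>, v\<^sub>l\<close> of type \<open>E\<^sub>l\<close> orthogonal to \<open>v\<^sub>0\<close>, and two thimbles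
  with boundaries \<open>a\<close> and \<open>b\<close>; the charge vanishes on \<open>v\<^sub>0, \<dots>, v\<^sub>l\<close>.  The roots are combinations of
  two or three thimbles whose boundaries cancel, such as differences of thimbles with the same
  boundary; \<open>v\<^sub>0\<close> spans the radical of the form on \<open>Ker c\<close>.  All of this is a finite computation for each
  of the three values of \<open>d\<close> (\<open>thimbles_adapted_lattice\<close>), and it shows that \<open>Ker c\<close> is the orthogonal sum
  of the root lattice and \<open>\<langle>v\<^sub>0\<rangle>\<close> (\<open>kernel_decomposition\<close>).

  It remains to recognise \<open>p\<close>.  As \<open>\<langle>p, y\<rangle> = \<langle>y, p\<rangle>\<close> for all \<open>y\<close>, it lies in \<open>Ker c\<close>.  If
  it were not orthogonal to some root \<open>v\<^sub>j\<close>, then suitable nonzero multiples of lifts of \<open>a\<close> and \<open>b\<close> could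
  be moved into \<open>p\<^sup>\<bottom>\<close> by adding multiples of \<open>v\<^sub>j\<close>; this does not affect their charges, so the
  form would not be symmetric on \<open>p\<^sup>\<bottom>\<close>.  The Cartan matrix is nondegenerate, hence \<open>p\<close> is a multiple of
  \<open>v\<^sub>0\<close>, and by primitivity \<open>p = \<plusminus>v\<^sub>0\<close> (\<open>point_like_eq_pow\<close>).

  For the second part, let \<open>E\<close> be any root lattice that complements \<open>\<langle>p\<rangle>\<close> in \<open>Ker c\<close>.  The determinant of
  the Cartan matrix is \<open>d\<close>, so for every class \<open>x\<close> the orthogonal projection of \<open>d x\<close> to \<open>E\<close> is integral, and
  subtracting it gives a class that is orthogonal to \<open>E\<close> and has charge \<open>d c(x)\<close>
  (\<open>orthogonal_lift\<close>).  The rational plane \<open>V\<close> spanned by such lifts of \<open>a\<close> and \<open>b\<close> is mapped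
  isomorphically by the charge (\<open>rational_splitting\<close>).
\<close>

section \<open>Bases of free abelian groups\<close>

abbreviation lincomb :: "('a, 'm) monoid_scheme \<Rightarrow> 'i set \<Rightarrow> ('i \<Rightarrow> 'a) \<Rightarrow> ('i \<Rightarrow> int) \<Rightarrow> 'a" where
  "lincomb G I e m \<equiv> (\<Otimes>\<^bsub>G\<^esub>i\<in>I. e i [^]\<^bsub>G\<^esub> m i)"

context comm_group
begin

lemma lincomb_closed:
  fixes m :: "'i \<Rightarrow> int"
  assumes "e \<in> I \<rightarrow> carrier G"
  shows "lincomb G I e m \<in> carrier G"
  using assms by (intro finprod_closed) auto

lemma lincomb_add:
  fixes m m' :: "'i \<Rightarrow> int"
  assumes "e \<in> I \<rightarrow> carrier G"
  shows "lincomb G I e (\<lambda>i. m i + m' i) = lincomb G I e m \<otimes> lincomb G I e m'"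
proof -
  have "lincomb G I e (\<lambda>i. m i + m' i) = (\<Otimes>i\<in>I. e i [^] m i \<otimes> e i [^] m' i)"
    using assms by (intro finprod_cong') (auto simp: int_pow_mult Pi_iff)
  also have "\<dots> = lincomb G I e m \<otimes> lincomb G I e m'"
    using assms by (intro finprod_multf) auto
  finally show ?thesis .
qed

lemma lincomb_cong:
  fixes m m' :: "'i \<Rightarrow> int"
  assumes "e \<in> I \<rightarrow> carrier G" "\<And>i. i \<in> I \<Longrightarrow> m i = m' i"
  shows "lincomb G I e m = lincomb G I e m'"
  using assms by (intro finprod_cong') auto

lemma lincomb_zero:
  fixes m :: "'i \<Rightarrow> int"
  assumes "\<And>i. i \<in> I \<Longrightarrow> m i = 0"
  shows "lincomb G I e m = \<one>"
  using assms by (intro finprod_one_eqI) auto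

lemma lincomb_pow:
  fixes m :: "'i \<Rightarrow> int"
  assumes "finite I" "e \<in> I \<rightarrow> carrier G"
  shows "lincomb G I e m [^] (k::int) = lincomb G I e (\<lambda>i. m i * k)"
  using assms
proof (induction I rule: finite_induct)
  case (insert j I)
  then have *: "e j \<in> carrier G" "e \<in> I \<rightarrow> carrier G" by auto
  then have "(\<lambda>i. e i [^] m i) \<in> I \<rightarrow> carrier G" "(\<lambda>i. e i [^] (m i * k)) \<in> I \<rightarrow> carrier G"
    by auto
  with insert * show ?case
    by (simp add: int_pow_distrib int_pow_pow)
qed simp

lemma lincomb_single:
  assumes "finite I" "e \<in> I \<rightarrow> carrier G" "j \<in> I"
  shows "lincomb G I e (\<lambda>i. if j = i then k else 0) = e j [^] (k::int)"
proof -
  have "lincomb G I e (\<lambda>i. if j = i then k else 0) = (\<Otimes>i\<in>I. if j = i then e i [^] k else \<one>)"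
    using assms by (intro finprod_cong') (auto simp: Pi_iff)
  also have "\<dots> = e j [^] k"
    using assms by (intro finprod_singleton) (auto simp: Pi_iff)
  finally show ?thesis .
qed

lemma hom_lincomb:
  fixes m :: "'i \<Rightarrow> int"
  assumes "comm_group H" "h \<in> hom G H" "finite I" "e \<in> I \<rightarrow> carrier G"
  shows "h (lincomb G I e m) = lincomb H I (\<lambda>i. h (e i)) m"
proof -
  interpret H: comm_group H by fact
  interpret h: group_hom G H h
    using assms(2) by unfold_locales
  show ?thesis
    using assms(3,4)
  proof (induction I rule: finite_induct)
    case (insert j I)
    then have *: "e j \<in> carrier G" "e \<in> I \<rightarrow> carrier G" by auto
    then have "(\<lambda>i. e i [^] m i) \<in> I \<rightarrow> carrier G" "(\<lambda>i. h (e i) [^]\<^bsub>H\<^esub> m i) \<in> I \<rightarrow> carrier H"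
      by (auto simp: Pi_iff)
    with insert * show ?case
      by (simp add: h.hom_int_pow)
  qed simp
qed

lemma lincomb_lincomb:
  fixes m :: "'i \<Rightarrow> int" and P :: "'i \<Rightarrow> 'j \<Rightarrow> int"
  assumes "finite I" "finite J" "e \<in> J \<rightarrow> carrier G"
  shows "lincomb G I (\<lambda>i. lincomb G J e (P i)) m = lincomb G J e (\<lambda>j. \<Sum>i\<in>I. m i * P i j)"
  using assms(1)
proof (induction I rule: finite_induct)
  case (insert k I)
  have c: "lincomb G J e (P i) \<in> carrier G" for i
    using assms by (intro lincomb_closed)
  have "lincomb G (insert k I) (\<lambda>i. lincomb G J e (P i)) m
      = lincomb G J e (P k) [^] m k \<otimes> lincomb G J e (\<lambda>j. \<Sum>i\<in>I. m i * P i j)"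
    using insert c by simp
  also have "\<dots> = lincomb G J e (\<lambda>j. P k j * m k + (\<Sum>i\<in>I. m i * P i j))"
    using assms by (simp add: lincomb_pow lincomb_add)
  also have "\<dots> = lincomb G J e (\<lambda>j. \<Sum>i\<in>insert k I. m i * P i j)"
    using insert by (simp add: mult.commute)
  finally show ?case .
qed (simp add: lincomb_zero)

lemma Z_basis_lincomb:
  assumes "Z_basis G I e" "x \<in> carrier G"
  obtains m :: "'i \<Rightarrow> int" where "x = lincomb G I e m"
  using assms unfolding Z_basis_def by blast

lemma Z_basis_closed:
  assumes "Z_basis G I e"
  shows "e \<in> I \<rightarrow> carrier G"
  using assms unfolding Z_basis_def by blast

lemma Z_basis_unique:
  assumes "Z_basis G I e" "lincomb G I e m = lincomb G I e m'" "i \<in> I"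
  shows "m i = m' i"
proof -
  have e: "e \<in> I \<rightarrow> carrier G" using assms(1) by (rule Z_basis_closed)
  let ?x = "lincomb G I e m"
  have "?x \<in> carrier G" by (rule lincomb_closed[OF e])
  then have "\<exists>!m. m \<in> extensional I \<and> ?x = lincomb G I e m"
    using assms(1) unfolding Z_basis_def by blast
  then obtain m\<^sub>0 where m\<^sub>0: "\<And>k. k \<in> extensional I \<Longrightarrow> ?x = lincomb G I e k \<Longrightarrow> k = m\<^sub>0"
    by (elim ex1E) blast
  have "?x = lincomb G I e (restrict m I)"
    by (rule lincomb_cong[OF e]) simp
  then have "restrict m I = m\<^sub>0" by (intro m\<^sub>0) simp
  moreover have "?x = lincomb G I e (restrict m' I)"
    unfolding assms(2) by (rule lincomb_cong[OF e]) simp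
  then have "restrict m' I = m\<^sub>0" by (intro m\<^sub>0) simp
  ultimately have "restrict m I i = restrict m' I i" by simp
  then show ?thesis
    using assms(3) by simp
qed

lemma Z_basisI:
  assumes e: "e \<in> I \<rightarrow> carrier G"
    and gen: "\<And>x. x \<in> carrier G \<Longrightarrow> \<exists>m::'i \<Rightarrow> int. x = lincomb G I e m"
    and indep: "\<And>(m::'i \<Rightarrow> int) m' i. lincomb G I e m = lincomb G I e m' \<Longrightarrow> i \<in> I \<Longrightarrow> m i = m' i"
  shows "Z_basis G I e"
  unfolding Z_basis_def
proof (intro conjI ballI e)
  fix x assume "x \<in> carrier G"
  then obtain m :: "'i \<Rightarrow> int" where m: "x = lincomb G I e m" using gen by blast
  show "\<exists>!m::'i \<Rightarrow> int. m \<in> extensional I \<and> x = lincomb G I e m"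
  proof (rule ex1I[of _ "restrict m I"])
    show "restrict m I \<in> extensional I \<and> x = lincomb G I e (restrict m I)"
      unfolding m by (intro conjI lincomb_cong[OF e]) auto
  next
    fix m' :: "'i \<Rightarrow> int"
    assume m': "m' \<in> extensional I \<and> x = lincomb G I e m'"
    then have "\<And>i. i \<in> I \<Longrightarrow> m' i = m i"
      using indep m by metis
    then show "m' = restrict m I"
      using m' by (auto simp: extensional_def restrict_def)
  qed
qed

text \<open>The equation \<open>Q P = 1\<close> expresses the old basis by the new elements, so that these generate, and
  \<open>P Q = 1\<close> makes them independent.\<close>

lemma Z_basis_change:
  fixes P Q :: "'i \<Rightarrow> 'i \<Rightarrow> int"
  assumes "finite I" and basis: "Z_basis G I e"
    and PQ: "\<And>i j. i \<in> I \<Longrightarrow> j \<in> I \<Longrightarrow> (\<Sum>k\<in>I. P i k * Q k j) = (if i = j then 1 else 0)"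
    and QP: "\<And>i j. i \<in> I \<Longrightarrow> j \<in> I \<Longrightarrow> (\<Sum>k\<in>I. Q i k * P k j) = (if i = j then 1 else 0)"
  shows "Z_basis G I (\<lambda>i. lincomb G I e (P i))"
proof (rule Z_basisI)
  have e: "e \<in> I \<rightarrow> carrier G" using basis by (rule Z_basis_closed)
  have comp: "(\<Sum>i\<in>I. (\<Sum>j\<in>I. m j * A j i) * B i k) = m k"
    if "\<And>i j. i \<in> I \<Longrightarrow> j \<in> I \<Longrightarrow> (\<Sum>k\<in>I. A i k * B k j) = (if i = j then 1 else 0)" "k \<in> I"
    for m :: "'i \<Rightarrow> int" and A B :: "'i \<Rightarrow> 'i \<Rightarrow> int" and k
  proof -
    have "(\<Sum>i\<in>I. (\<Sum>j\<in>I. m j * A j i) * B i k) = (\<Sum>j\<in>I. m j * (\<Sum>i\<in>I. A j i * B i k))"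
      by (simp add: sum_distrib_right sum_distrib_left mult.assoc) (rule sum.swap)
    also have "\<dots> = (\<Sum>j\<in>I. m j * (if j = k then 1 else 0))"
      using that by (intro sum.cong) auto
    also have "\<dots> = m k"
      using that \<open>finite I\<close> by (simp add: if_distrib cong: if_cong)
    finally show ?thesis .
  qed
  show "(\<lambda>i. lincomb G I e (P i)) \<in> I \<rightarrow> carrier G"
    using lincomb_closed[OF e] by auto
  show "\<exists>m. x = lincomb G I (\<lambda>i. lincomb G I e (P i)) m" if "x \<in> carrier G" for x
  proof -
    obtain m where "x = lincomb G I e m" using Z_basis_lincomb[OF basis \<open>x \<in> carrier G\<close>] .
    also have "\<dots> = lincomb G I e (\<lambda>k. \<Sum>i\<in>I. (\<Sum>j\<in>I. m j * Q j i) * P i k)"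
      by (rule lincomb_cong[OF e]) (simp add: comp[OF QP])
    also have "\<dots> = lincomb G I (\<lambda>i. lincomb G I e (P i)) (\<lambda>i. \<Sum>j\<in>I. m j * Q j i)"
      using \<open>finite I\<close> e by (simp add: lincomb_lincomb)
    finally show ?thesis by (rule exI[where x = "\<lambda>i. \<Sum>j\<in>I. m j * Q j i"])
  qed
  have comp': "(\<Sum>k\<in>I. (\<Sum>i\<in>I. m i * P i k) * Q k i) = m i" if "i \<in> I"
    for m :: "'i \<Rightarrow> int" and i
    using PQ that by (rule comp)
  show "m i = m' i"
    if "lincomb G I (\<lambda>i. lincomb G I e (P i)) m = lincomb G I (\<lambda>i. lincomb G I e (P i)) m'" "i \<in> I"
    for m m' :: "'i \<Rightarrow> int" and i
  proof -
    have "lincomb G I e (\<lambda>k. \<Sum>i\<in>I. m i * P i k) = lincomb G I e (\<lambda>k. \<Sum>i\<in>I. m' i * P i k)"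
      using that(1) unfolding lincomb_lincomb[OF \<open>finite I\<close> \<open>finite I\<close> e] .
    then have "(\<Sum>i\<in>I. m i * P i k) = (\<Sum>i\<in>I. m' i * P i k)" if "k \<in> I" for k
      using Z_basis_unique[OF basis] that by meson
    then have "(\<Sum>k\<in>I. (\<Sum>i\<in>I. m i * P i k) * Q k i) = (\<Sum>k\<in>I. (\<Sum>i\<in>I. m' i * P i k) * Q k i)"
      by (intro sum.cong) auto
    then show ?thesis
      unfolding comp'[OF \<open>i \<in> I\<close>] .
  qed
qed

lemma lincomb_extend:
  fixes m :: "'i \<Rightarrow> int"
  assumes "finite I" "J \<subseteq> I" "e \<in> I \<rightarrow> carrier G"
  shows "lincomb G J e m = lincomb G I e (\<lambda>i. if i \<in> J then m i else 0)"
  using assms by (intro finprod_mono_neutral_cong_left) (auto simp: Pi_iff)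

lemma lincomb_const:
  fixes m :: "'i \<Rightarrow> int"
  assumes "finite I" "x \<in> carrier G"
  shows "lincomb G I (\<lambda>_. x) m = x [^] (\<Sum>i\<in>I. m i)"
  using assms by (induction I rule: finite_induct) (simp_all add: int_pow_mult)

lemma comm_group_subgroup:
  assumes "subgroup E G"
  shows "comm_group (G\<lparr>carrier := E\<rparr>)"
  using subgroup.subgroup_is_group[OF assms is_group]
  by (rule group.group_comm_groupI) (simp add: m_comm subgroup.mem_carrier[OF assms])

lemma lincomb_subgroup:
  fixes m :: "'i \<Rightarrow> int"
  assumes "subgroup E G" "finite I" "e \<in> I \<rightarrow> E"
  shows "lincomb (G\<lparr>carrier := E\<rparr>) I e m = lincomb G I e m"
proof -
  interpret E: comm_group "G\<lparr>carrier := E\<rparr>"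
    using assms(1) by (rule comm_group_subgroup)
  show ?thesis
    using E.hom_lincomb[OF comm_group_axioms, of "\<lambda>x. x" I e m] assms subgroup.subset[OF assms(1)]
    by (auto simp: hom_def Pi_iff)
qed

lemma lincomb_in_subgroup:
  fixes m :: "'i \<Rightarrow> int"
  assumes "subgroup E G" "finite I" "e \<in> I \<rightarrow> E"
  shows "lincomb G I e m \<in> E"
  using comm_group.lincomb_closed[OF comm_group_subgroup[OF assms(1)], of e I m] assms(3)
  by (simp add: lincomb_subgroup[OF assms])

lemma subgroup_lincombs:
  assumes e: "e \<in> I \<rightarrow> carrier G"
  shows "subgroup (range (\<lambda>m::'i \<Rightarrow> int. lincomb G I e m)) G"
proof (rule subgroupI)
  show "range (lincomb G I e) \<subseteq> carrier G"
    using lincomb_closed[OF e] by blast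
next
  fix x assume "x \<in> range (lincomb G I e)"
  then obtain m where m: "x = lincomb G I e m" by blast
  have "lincomb G I e (\<lambda>i. - m i) \<otimes> x = \<one>"
    unfolding m using lincomb_add[OF e, of "\<lambda>i. - m i" m] by (simp add: lincomb_zero)
  then have "inv x = lincomb G I e (\<lambda>i. - m i)"
    by (rule inv_equality) (simp_all add: m lincomb_closed[OF e])
  then show "inv x \<in> range (lincomb G I e)" by (intro range_eqI)
next
  fix x y assume "x \<in> range (lincomb G I e)" "y \<in> range (lincomb G I e)"
  then obtain m m' where "x = lincomb G I e m" "y = lincomb G I e m'" by blast
  then have "x \<otimes> y = lincomb G I e (\<lambda>i. m i + m' i)"
    by (simp add: lincomb_add[OF e])
  then show "x \<otimes> y \<in> range (lincomb G I e)" by (intro range_eqI)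
qed blast

lemma Z_basis_subset:
  assumes basis: "Z_basis G I e" and "finite I" "J \<subseteq> I"
  shows "Z_basis (G\<lparr>carrier := range (\<lambda>m::'i \<Rightarrow> int. lincomb G J e m)\<rparr>) J e"
proof -
  let ?E = "range (\<lambda>m::'i \<Rightarrow> int. lincomb G J e m)"
  have eI: "e \<in> I \<rightarrow> carrier G" using basis by (rule Z_basis_closed)
  then have e: "e \<in> J \<rightarrow> carrier G" using \<open>J \<subseteq> I\<close> by blast
  have "finite J" using assms(2,3) by (rule rev_finite_subset)
  have sub: "subgroup ?E G" using e by (rule subgroup_lincombs)
  have eE: "e \<in> J \<rightarrow> ?E"
  proof
    fix j assume "j \<in> J"
    then have "e j = lincomb G J e (\<lambda>i. if j = i then 1 else 0)"
      using lincomb_single[OF \<open>finite J\<close> e, of j 1] e by (simp add: Pi_iff)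
    then show "e j \<in> ?E" by (intro range_eqI)
  qed
  interpret E: comm_group "G\<lparr>carrier := ?E\<rparr>"
    using sub by (rule comm_group_subgroup)
  show ?thesis
  proof (rule E.Z_basisI)
    show "e \<in> J \<rightarrow> carrier (G\<lparr>carrier := ?E\<rparr>)" using eE by simp
    show "\<exists>m. x = lincomb (G\<lparr>carrier := ?E\<rparr>) J e m" if "x \<in> carrier (G\<lparr>carrier := ?E\<rparr>)" for x
      using that unfolding lincomb_subgroup[OF sub \<open>finite J\<close> eE] by auto
    show "m i = m' i" if "lincomb (G\<lparr>carrier := ?E\<rparr>) J e m = lincomb (G\<lparr>carrier := ?E\<rparr>) J e m'" "i \<in> J"
      for m m' :: "'i \<Rightarrow> int" and i
    proof -
      have "i \<in> I" using that \<open>J \<subseteq> I\<close> by blast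
      have "lincomb G J e m = lincomb G J e m'"
        using that(1) unfolding lincomb_subgroup[OF sub \<open>finite J\<close> eE] .
      then have "lincomb G I e (\<lambda>i. if i \<in> J then m i else 0) = lincomb G I e (\<lambda>i. if i \<in> J then m' i else 0)"
        unfolding lincomb_extend[OF assms(2,3) eI] .
      from Z_basis_unique[OF basis this \<open>i \<in> I\<close>] show ?thesis using that by simp
    qed
  qed
qed

end

section \<open>Integral bilinear forms\<close>

lemma bilinear_form_add:
  assumes "bilinear_form G B" "x \<in> carrier G" "y \<in> carrier G" "z \<in> carrier G"
  shows "B (x \<otimes>\<^bsub>G\<^esub> y) z = B x z + B y z" "B z (x \<otimes>\<^bsub>G\<^esub> y) = B z x + B z y"
  using assms by (simp_all add: bilinear_form_def)

lemma finprod_integer_group: "finprod integer_group f I = sum f I"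
proof -
  interpret comm_group integer_group by (rule abelian_integer_group)
  show ?thesis by (induction I rule: infinite_finite_induct) auto
qed

lemma bilinear_form_lincomb_left:
  fixes m :: "'i \<Rightarrow> int"
  assumes "comm_group G" "bilinear_form G B" "finite I" "e \<in> I \<rightarrow> carrier G" "z \<in> carrier G"
  shows "B (lincomb G I e m) z = (\<Sum>i\<in>I. m i * B (e i) z)"
proof -
  interpret comm_group G by fact
  have "(\<lambda>x. B x z) \<in> hom G integer_group"
    using assms by (auto simp: hom_def bilinear_form_def)
  then have "B (lincomb G I e m) z = lincomb integer_group I (\<lambda>i. B (e i) z) m"
    using abelian_integer_group hom_lincomb[of integer_group "\<lambda>x. B x z" I e m] assms by simp
  also have "\<dots> = (\<Sum>i\<in>I. m i * B (e i) z)"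
    by (simp add: finprod_integer_group)
  finally show ?thesis .
qed

lemma bilinear_form_lincomb_right:
  fixes m :: "'i \<Rightarrow> int"
  assumes "comm_group G" "bilinear_form G B" "finite I" "e \<in> I \<rightarrow> carrier G" "z \<in> carrier G"
  shows "B z (lincomb G I e m) = (\<Sum>i\<in>I. m i * B z (e i))"
proof -
  have "bilinear_form G (\<lambda>x y. B y x)"
    using assms(2) by (auto simp: bilinear_form_def)
  then show ?thesis
    using bilinear_form_lincomb_left[of G "\<lambda>x y. B y x"] assms by blast
qed

lemma bilinear_form_eqI:
  assumes G: "comm_group G" and basis: "finite I" "Z_basis G I e"
    and B: "bilinear_form G B" "bilinear_form G B'"
    and eq: "\<And>i j. i \<in> I \<Longrightarrow> j \<in> I \<Longrightarrow> B (e i) (e j) = B' (e i) (e j)"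
    and "x \<in> carrier G" "y \<in> carrier G"
  shows "B x y = B' x y"
proof -
  interpret comm_group G by fact
  have e: "e \<in> I \<rightarrow> carrier G" using basis(2) by (rule Z_basis_closed)
  obtain m where m: "x = lincomb G I e m" using Z_basis_lincomb[OF basis(2) \<open>x \<in> carrier G\<close>] .
  obtain k where k: "y = lincomb G I e k" using Z_basis_lincomb[OF basis(2) \<open>y \<in> carrier G\<close>] .
  have ex: "B z y = (\<Sum>j\<in>I. k j * B z (e j))" "B' z y = (\<Sum>j\<in>I. k j * B' z (e j))"
    if "z \<in> carrier G" for z
    unfolding k using that B basis e G by (auto intro: bilinear_form_lincomb_right)
  have "B x y = (\<Sum>i\<in>I. m i * B (e i) y)" "B' x y = (\<Sum>i\<in>I. m i * B' (e i) y)"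
    unfolding m using B basis e G \<open>y \<in> carrier G\<close> by (auto intro: bilinear_form_lincomb_left)
  moreover have "B (e i) y = B' (e i) y" if "i \<in> I" for i
    using ex[of "e i"] e eq that by (auto simp: Pi_iff)
  ultimately show ?thesis by simp
qed

lemma bilinear_form_pow:
  assumes "comm_group G" "bilinear_form G B" "x \<in> carrier G" "z \<in> carrier G"
  shows "B (x [^]\<^bsub>G\<^esub> (k::int)) z = k * B x z" "B z (x [^]\<^bsub>G\<^esub> k) = k * B z x"
proof -
  interpret comm_group G by fact
  have "lincomb G {()} (\<lambda>_. x) (\<lambda>_. k) = x [^]\<^bsub>G\<^esub> k"
    using assms by simp
  with bilinear_form_lincomb_left[of G B "{()}" "\<lambda>_. x" z "\<lambda>_. k"]
    bilinear_form_lincomb_right[of G B "{()}" "\<lambda>_. x" z "\<lambda>_. k"] assms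
  show "B (x [^]\<^bsub>G\<^esub> (k::int)) z = k * B x z" "B z (x [^]\<^bsub>G\<^esub> k) = k * B z x"
    by simp_all
qed

lemma alternating_antisym:
  assumes "comm_group H" "bilinear_form H Q" "\<forall>x\<in>carrier H. Q x x = 0" "x \<in> carrier H" "y \<in> carrier H"
  shows "Q x y = - Q y x"
proof -
  interpret comm_group H by fact
  have xy: "x \<otimes>\<^bsub>H\<^esub> y \<in> carrier H" using assms(4,5) by simp
  have "Q (x \<otimes>\<^bsub>H\<^esub> y) (x \<otimes>\<^bsub>H\<^esub> y) = Q x (x \<otimes>\<^bsub>H\<^esub> y) + Q y (x \<otimes>\<^bsub>H\<^esub> y)"
    "Q x (x \<otimes>\<^bsub>H\<^esub> y) = Q x x + Q x y" "Q y (x \<otimes>\<^bsub>H\<^esub> y) = Q y x + Q y y"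
    using assms(2,4,5) xy unfolding bilinear_form_def by blast+
  moreover have "Q (x \<otimes>\<^bsub>H\<^esub> y) (x \<otimes>\<^bsub>H\<^esub> y) = 0" "Q x x = 0" "Q y y = 0"
    using assms(3,4,5) xy by blast+
  ultimately show ?thesis by linarith
qed

text \<open>The alternating form with \<open>Q a b = - 1\<close> is minus the determinant in the coordinates for \<open>a, b\<close>.\<close>

lemma intersection_pairing_coords:
  assumes "comm_group H" and isect: "intersection_pairing H a b Q" and ab: "a \<in> carrier H" "b \<in> carrier H"
  shows "Q (a [^]\<^bsub>H\<^esub> (m::int) \<otimes>\<^bsub>H\<^esub> b [^]\<^bsub>H\<^esub> (n::int)) (a [^]\<^bsub>H\<^esub> (m'::int) \<otimes>\<^bsub>H\<^esub> b [^]\<^bsub>H\<^esub> (n'::int))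
    = n * m' - m * n'"
proof -
  interpret comm_group H by fact
  have Q: "bilinear_form H Q" "\<forall>x\<in>carrier H. Q x x = 0" "Q a b = -1"
    using isect by (auto simp: intersection_pairing_def)
  then have "Q b a = 1" "Q a a = 0" "Q b b = 0"
    using alternating_antisym[OF comm_group_axioms Q(1,2), of b a] ab by auto
  then show ?thesis
    using ab Q(3) by (simp add: bilinear_form_add[OF Q(1)] bilinear_form_pow[OF comm_group_axioms Q(1)])
qed

section \<open>Lattices with a basis adapted to the charge\<close>

lemma cartan_E_sym: "cartan_E i j = cartan_E j i"
  by (auto simp: cartan_E_def E_edge_def insert_commute)

text \<open>In the basis \<open>v\<close>, the element \<open>v 0\<close> will span the point-like classes, \<open>v 1, \<dots>, v l\<close> are simple
  roots in Bourbaki's order, and the last two elements lift \<open>a, b\<close>.  The matrix \<open>M\<close> is \<open>d\<close> times the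
  inverse of the Cartan matrix; it carries the nondegeneracy of the root lattice, both to pin down the
  point-like classes and to project orthogonally to the roots without leaving the integers.\<close>

locale adapted_lattice = comm_group G + H: comm_group H
  for G :: "('a, 'm) monoid_scheme" (structure) and H :: "('b, 'n) monoid_scheme" +
  fixes c :: "'a \<Rightarrow> 'b" and B :: "'a \<Rightarrow> 'a \<Rightarrow> int" and Q :: "'b \<Rightarrow> 'b \<Rightarrow> int"
    and v :: "nat \<Rightarrow> 'a" and a b :: 'b and l d :: nat and M :: "nat \<Rightarrow> nat \<Rightarrow> int"
  assumes c_hom: "c \<in> hom G H"
    and basis: "Z_basis G {..<l + 3} v"
    and basis_H: "Z_basis H {..<2::nat} ((!) [a, b])"
    and bilinear: "bilinear_form G B"
    and isect: "intersection_pairing H a b Q"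
    and antisymmetrisation: "\<And>x y. x \<in> carrier G \<Longrightarrow> y \<in> carrier G \<Longrightarrow> B x y - B y x = Q (c x) (c y)"
    and charge_kernel: "\<And>i. i \<le> l \<Longrightarrow> c (v i) = \<one>\<^bsub>H\<^esub>"
    and charge_lifts: "c (v (l + 1)) = a" "c (v (l + 2)) = b"
    and gram_roots: "\<And>i j. i \<in> {1..l} \<Longrightarrow> j \<in> {1..l} \<Longrightarrow> B (v i) (v j) = cartan_E i j"
    and gram_point: "\<And>i. i \<le> l \<Longrightarrow> B (v 0) (v i) = 0"
    and d_pos: "d > 0"
    and cartan_inverse: "\<And>i k. i \<in> {1..l} \<Longrightarrow> k \<in> {1..l} \<Longrightarrow>
          (\<Sum>j\<in>{1..l}. cartan_E i j * M j k) = (if i = k then int d else 0)"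
begin

sublocale c: group_hom G H c
  using c_hom by unfold_locales

lemma v_closed [simp, intro]: "i < l + 3 \<Longrightarrow> v i \<in> carrier G"
  using Z_basis_closed[OF basis] by (auto simp: Pi_iff)

lemma v_roots_closed: "v \<in> {1..l} \<rightarrow> carrier G"
  by auto

lemma ab_closed [simp, intro]: "a \<in> carrier H" "b \<in> carrier H"
  using charge_lifts c.hom_closed[of "v (l + 1)"] c.hom_closed[of "v (l + 2)"] by auto

lemma H_lincomb: "lincomb H {..<2} ((!) [a, b]) m = a [^]\<^bsub>H\<^esub> m 0 \<otimes>\<^bsub>H\<^esub> b [^]\<^bsub>H\<^esub> m (Suc 0)"
proof -
  have "{..<2::nat} = insert 0 {Suc 0}" by auto
  then show ?thesis by simp
qed

lemma ab_coords:
  assumes "h \<in> carrier H"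
  obtains s t :: int where "h = a [^]\<^bsub>H\<^esub> s \<otimes>\<^bsub>H\<^esub> b [^]\<^bsub>H\<^esub> t"
  using H.Z_basis_lincomb[OF basis_H assms] H_lincomb by metis

lemma ab_independent:
  assumes "a [^]\<^bsub>H\<^esub> (s::int) \<otimes>\<^bsub>H\<^esub> b [^]\<^bsub>H\<^esub> (t::int) = \<one>\<^bsub>H\<^esub>"
  shows "s = 0 \<and> t = 0"
proof -
  define m where "m = (\<lambda>i::nat. if i = 0 then s else t)"
  have "lincomb H {..<2} ((!) [a, b]) m = lincomb H {..<2} ((!) [a, b]) (\<lambda>i. 0)"
    unfolding H_lincomb using assms by (simp add: m_def)
  from H.Z_basis_unique[OF basis_H this] have "m i = 0" if "i < 2" for i
    using that by simp
  from this[of 0] this[of 1] show ?thesis by (simp add: m_def)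
qed

lemma lincomb_split:
  "lincomb G {..<l + 3} v m =
     v 0 [^] m 0 \<otimes> lincomb G {1..l} v m \<otimes> (v (l + 1) [^] m (l + 1) \<otimes> v (l + 2) [^] m (l + 2))"
proof -
  have "{..<l + 3} = insert 0 (insert (l + 1) (insert (l + 2) {1..l}))" by auto
  then show ?thesis
    by (simp add: Pi_iff m_ac)
qed

lemma coords:
  assumes "x \<in> carrier G"
  obtains m where "x = v 0 [^] m 0 \<otimes> lincomb G {1..l} v m \<otimes> (v (l + 1) [^] m (l + 1) \<otimes> v (l + 2) [^] m (l + 2))"
  using Z_basis_lincomb[OF basis assms] lincomb_split by metis

lemma charge_roots: "c (lincomb G {1..l} v m) = \<one>\<^bsub>H\<^esub>"
proof -
  have "c (lincomb G {1..l} v m) = lincomb H {1..l} (\<lambda>i. c (v i)) m"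
    by (rule hom_lincomb[OF H.comm_group_axioms c_hom _ v_roots_closed]) simp
  also have "\<dots> = \<one>\<^bsub>H\<^esub>"
    by (rule H.finprod_one_eqI) (simp add: charge_kernel)
  finally show ?thesis .
qed

lemma charge_coords:
  "c (v 0 [^] m 0 \<otimes> lincomb G {1..l} v m \<otimes> (v (l + 1) [^] m (l + 1) \<otimes> v (l + 2) [^] m (l + 2)))
     = a [^]\<^bsub>H\<^esub> (m (l + 1) :: int) \<otimes>\<^bsub>H\<^esub> b [^]\<^bsub>H\<^esub> (m (l + 2) :: int)"
  using charge_lifts charge_kernel[of 0] charge_roots[of m] lincomb_closed[OF v_roots_closed, of m]
  by (simp add: c.hom_int_pow)

lemma kernel_coords:
  assumes "x \<in> kernel G H c"
  obtains k m where "x = v 0 [^] (k::int) \<otimes> lincomb G {1..l} v m"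
proof -
  have x: "x \<in> carrier G" "c x = \<one>\<^bsub>H\<^esub>" using assms by (auto simp: kernel_def)
  obtain m where m: "x = v 0 [^] m 0 \<otimes> lincomb G {1..l} v m \<otimes> (v (l + 1) [^] m (l + 1) \<otimes> v (l + 2) [^] m (l + 2))"
    using coords[OF x(1)] .
  have "m (l + 1) = 0 \<and> m (l + 2) = 0"
    using x(2) unfolding m charge_coords by (rule ab_independent)
  then have "x = v 0 [^] m 0 \<otimes> lincomb G {1..l} v m"
    unfolding m using lincomb_closed[OF v_roots_closed, of m] by simp
  then show thesis by (rule that)
qed

text \<open>The antisymmetrisation of \<open>B\<close> factors through the charge.\<close>

lemma kernel_symmetric:
  assumes "x \<in> kernel G H c" "y \<in> carrier G"
  shows "B x y = B y x"
proof -
  have "bilinear_form H Q" using isect by (simp add: intersection_pairing_def)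
  then have "Q (\<one>\<^bsub>H\<^esub> \<otimes>\<^bsub>H\<^esub> \<one>\<^bsub>H\<^esub>) (c y) = Q \<one>\<^bsub>H\<^esub> (c y) + Q \<one>\<^bsub>H\<^esub> (c y)"
    by (rule bilinear_form_add) (simp_all add: assms(2))
  then have "Q \<one>\<^bsub>H\<^esub> (c y) = 0" by simp
  then show ?thesis
    using antisymmetrisation[of x y] assms by (simp add: kernel_def)
qed

lemma v_kernel: "i \<le> l \<Longrightarrow> v i \<in> kernel G H c"
  by (simp add: kernel_def charge_kernel)

lemma Q_pow:
  "Q (a [^]\<^bsub>H\<^esub> (s::int) \<otimes>\<^bsub>H\<^esub> b [^]\<^bsub>H\<^esub> (t::int)) a = t"
  "Q (a [^]\<^bsub>H\<^esub> s \<otimes>\<^bsub>H\<^esub> b [^]\<^bsub>H\<^esub> t) b = - s"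
  "Q (a [^]\<^bsub>H\<^esub> s) (b [^]\<^bsub>H\<^esub> t) = - (s * t)"
  using intersection_pairing_coords[OF H.comm_group_axioms isect ab_closed, of s t 1 0]
    intersection_pairing_coords[OF H.comm_group_axioms isect ab_closed, of s t 0 1]
    intersection_pairing_coords[OF H.comm_group_axioms isect ab_closed, of s 0 0 t]
  by simp_all

lemmas B_add = bilinear_form_add[OF bilinear]

lemma B_pow:
  assumes "x \<in> carrier G" "z \<in> carrier G"
  shows "B (x [^] (k::int)) z = k * B x z" "B z (x [^] k) = k * B z x"
  using bilinear_form_pow[OF comm_group_axioms bilinear] assms by blast+

lemma cartan_nondegenerate:
  assumes "\<And>j. j \<in> {1..l} \<Longrightarrow> (\<Sum>i\<in>{1..l}. m i * cartan_E i j) = (0::int)" "k \<in> {1..l}"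
  shows "m k = 0"
proof -
  have "(\<Sum>j\<in>{1..l}. (\<Sum>i\<in>{1..l}. m i * cartan_E i j) * M j k) = 0"
    using assms(1) by simp
  also have "(\<Sum>j\<in>{1..l}. (\<Sum>i\<in>{1..l}. m i * cartan_E i j) * M j k)
      = (\<Sum>i\<in>{1..l}. m i * (\<Sum>j\<in>{1..l}. cartan_E i j * M j k))"
    by (simp add: sum_distrib_right sum_distrib_left mult.assoc) (rule sum.swap)
  also have "\<dots> = (\<Sum>i\<in>{1..l}. m i * (if i = k then int d else 0))"
    by (intro sum.cong refl arg_cong2[where f = "(*)"] cartan_inverse assms(2))
  also have "\<dots> = m k * int d"
    using assms(2) by (simp add: if_distrib cong: if_cong)
  finally show ?thesis using d_pos by simp
qed

text \<open>Since \<open>B(p, x) = B(x, p)\<close> for all \<open>x\<close>, the charge of \<open>p\<close> is orthogonal to \<open>a\<close> and \<open>b\<close>, hence trivial.  The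
  symmetry on \<open>p\<^sup>\<bottom>\<close> excludes root components: \<open>p\<^sup>\<bottom>\<close> would otherwise contain classes whose charges
  are nonzero multiples of \<open>a\<close> and \<open>b\<close>, and \<open>B\<close> is not symmetric on these.  Primitivity fixes the multiple
  of \<open>v 0\<close> up to sign.\<close>

lemma point_like_eq_pow:
  assumes "point_like G B p"
  obtains k :: int where "p = v 0 [^] k" "\<bar>k\<bar> = 1"
proof -
  have p: "p \<in> carrier G"
    and prim: "\<And>y n. y \<in> carrier G \<Longrightarrow> p = y [^] (n::int) \<Longrightarrow> \<bar>n\<bar> = 1"
    and sym: "\<And>x. x \<in> carrier G \<Longrightarrow> B p x = B x p"
    and perp: "\<And>x y. x \<in> carrier G \<Longrightarrow> y \<in> carrier G \<Longrightarrow> B p x = 0 \<Longrightarrow> B p y = 0 \<Longrightarrow> B x y = B y x"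
    using assms by (auto simp: point_like_def primitive_def)
  have "p \<in> kernel G H c"
  proof -
    obtain s t :: int where st: "c p = a [^]\<^bsub>H\<^esub> s \<otimes>\<^bsub>H\<^esub> b [^]\<^bsub>H\<^esub> t"
      by (rule ab_coords[OF c.hom_closed[OF p]])
    have "Q (c p) (c x) = 0" if "x \<in> carrier G" for x
      using antisymmetrisation[OF p that] sym[OF that] by simp
    from this[of "v (l + 1)"] this[of "v (l + 2)"] have "s = 0" "t = 0"
      using charge_lifts Q_pow[of s t] st by simp_all
    then show ?thesis using st p by (simp add: kernel_def)
  qed
  then obtain k m where km: "p = v 0 [^] (k::int) \<otimes> lincomb G {1..l} v m"
    by (rule kernel_coords)
  have ortho: "B p (v j) = 0" if j: "j \<in> {1..l}" for j
  proof (rule ccontr)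
    assume nz: "B p (v j) \<noteq> 0"
    define r where "r = B p (v j)"
    \<comment> \<open>In additive notation \<open>f x = r x - B(p, x) v\<^sub>j\<close>: as \<open>B(p, v\<^sub>j) = r\<close>, this moves \<open>x\<close> into \<open>p\<^sup>\<bottom>\<close>, and it multiplies the charge by \<open>r\<close>.\<close>
    define f where "f x = x [^] r \<otimes> v j [^] (- B p x)" for x
    have vj: "v j \<in> carrier G" "c (v j) = \<one>\<^bsub>H\<^esub>"
      using j charge_kernel by auto
    have f: "f x \<in> carrier G" "B p (f x) = 0" "c (f x) = c x [^]\<^bsub>H\<^esub> r" if "x \<in> carrier G" for x
      using that vj p by (simp_all add: f_def r_def B_add B_pow c.hom_int_pow)
    have "Q (c (f (v (l + 1)))) (c (f (v (l + 2)))) = 0"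
      using antisymmetrisation[of "f (v (l + 1))" "f (v (l + 2))"]
        perp[of "f (v (l + 1))" "f (v (l + 2))"] f by simp
    then have "r * r = 0"
      using f(3) charge_lifts Q_pow(3)[of r r] by simp
    then show False using nz by (simp add: r_def)
  qed
  have "(\<Sum>i\<in>{1..l}. m i * cartan_E i j) = 0" if j: "j \<in> {1..l}" for j
  proof -
    have vj: "v j \<in> carrier G" using j by auto
    have "B (lincomb G {1..l} v m) (v j) = (\<Sum>i\<in>{1..l}. m i * B (v i) (v j))"
      using bilinear_form_lincomb_left[OF comm_group_axioms bilinear _ v_roots_closed vj] by simp
    also have "\<dots> = (\<Sum>i\<in>{1..l}. m i * cartan_E i j)"
      using j by (intro sum.cong) (simp_all add: gram_roots)
    finally show ?thesis
      using ortho[OF j] vj gram_point[of j] j lincomb_closed[OF v_roots_closed, of m]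
      by (simp add: km B_add B_pow)
  qed
  then have "m i = 0" if "i \<in> {1..l}" for i
    using cartan_nondegenerate that by blast
  then have pk: "p = v 0 [^] k"
    using km lincomb_zero[of "{1..l}" m v] by simp
  show thesis
    by (rule that[OF pk prim[OF _ pk]]) simp
qed

lemma generate_point:
  assumes "point_like G B p"
  shows "generate G {p} = generate G {v 0}"
proof -
  obtain k :: int where k: "p = v 0 [^] k" "\<bar>k\<bar> = 1" using point_like_eq_pow[OF assms] .
  have inv: "generate G {inv (v 0)} = generate G {v 0}"
  proof -
    have *: "generate G {inv x} \<subseteq> generate G {x}" if "x \<in> carrier G" for x
    proof (rule generate_subgroup_incl)
      show "{inv x} \<subseteq> generate G {x}" by (simp add: generate.inv)
      show "subgroup (generate G {x}) G" using that by (intro generate_is_subgroup) simp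
    qed
    show ?thesis
    proof
      show "generate G {inv (v 0)} \<subseteq> generate G {v 0}" by (rule *) simp
      show "generate G {v 0} \<subseteq> generate G {inv (v 0)}" using *[of "inv (v 0)"] by simp
    qed
  qed
  from k(2) consider "k = 1" | "k = - 1" by linarith
  then show ?thesis
  proof cases
    case 1
    then show ?thesis by (simp add: k(1))
  next
    case 2
    then have "p = inv (v 0)" by (simp add: k(1) int_pow_neg)
    then show ?thesis by (simp only: inv)
  qed
qed

lemma kernel_decomposition:
  defines "E \<equiv> range (\<lambda>m. lincomb G {1..l} v m)"
  shows "E_root_lattice G B l E" and "orthogonal_sum G B (kernel G H c) E (generate G {v 0})"
proof -
  have sub: "subgroup E G"
    unfolding E_def using v_roots_closed by (rule subgroup_lincombs)
  have "Z_basis (G\<lparr>carrier := E\<rparr>) {1..l} v"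
    unfolding E_def using basis by (rule Z_basis_subset) auto
  then show "E_root_lattice G B l E"
    unfolding E_root_lattice_def using sub gram_roots by blast
  have gen: "generate G {v 0} = range (\<lambda>k::int. v 0 [^] k)"
    by (auto simp: generate_pow)
  have disj: "E \<inter> range (\<lambda>k::int. v 0 [^] k) = {\<one>}"
  proof -
    have roots: "{1..l} \<subseteq> {..<l + 3}" by auto
    have "x = \<one>" if x: "x = lincomb G {1..l} v m" "x = v 0 [^] k" for x m and k :: int
    proof -
      have "x = lincomb G {..<l + 3} v (\<lambda>i. if i \<in> {1..l} then m i else 0)"
        unfolding x(1) by (rule lincomb_extend[OF finite_lessThan roots Z_basis_closed[OF basis]])
      moreover have "lincomb G {..<l + 3} v (\<lambda>i. if 0 = i then k else 0) = x"
        unfolding x(2) by (rule lincomb_single[OF finite_lessThan Z_basis_closed[OF basis]]) simp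
      ultimately have "lincomb G {..<l + 3} v (\<lambda>i. if 0 = i then k else 0)
          = lincomb G {..<l + 3} v (\<lambda>i. if i \<in> {1..l} then m i else 0)"
        by (rule trans[rotated])
      from Z_basis_unique[OF basis this, of 0] have "k = 0" by simp
      then show ?thesis using x by simp
    qed
    moreover have "\<one> \<in> E" using sub by (rule subgroup.one_closed)
    moreover have "\<one> = v 0 [^] (0::int)" by simp
    ultimately show ?thesis unfolding E_def by blast
  qed
  have "kernel G H c = E <#> range (\<lambda>k::int. v 0 [^] k)"
  proof (intro equalityI subsetI)
    fix x assume "x \<in> kernel G H c"
    then obtain k m where "x = v 0 [^] (k::int) \<otimes> lincomb G {1..l} v m"
      by (rule kernel_coords)
    then have "x = lincomb G {1..l} v m \<otimes> v 0 [^] k"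
      using lincomb_closed[OF v_roots_closed, of m] by (simp add: m_comm)
    then show "x \<in> E <#> range (\<lambda>k::int. v 0 [^] k)"
      unfolding set_mult_def E_def by blast
  next
    fix x assume "x \<in> E <#> range (\<lambda>k::int. v 0 [^] k)"
    then obtain k :: int and m where "x = lincomb G {1..l} v m \<otimes> v 0 [^] k"
      unfolding set_mult_def E_def by blast
    then show "x \<in> kernel G H c"
      using lincomb_closed[OF v_roots_closed, of m] charge_roots[of m] charge_kernel[of 0]
      by (simp add: kernel_def c.hom_int_pow)
  qed
  moreover have "B x (v 0 [^] k) = 0 \<and> B (v 0 [^] k) x = 0" if "x \<in> E" for x and k :: int
  proof -
    obtain m where m: "x = lincomb G {1..l} v m" using \<open>x \<in> E\<close> unfolding E_def by blast
    have "B (v i) (v 0) = 0" if "i \<in> {1..l}" for i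
      using gram_point[of i] kernel_symmetric[OF v_kernel, of i "v 0"] that by simp
    then have "B x (v 0) = 0"
      unfolding m using bilinear_form_lincomb_left[OF comm_group_axioms bilinear _ v_roots_closed, of "v 0" m]
      by simp
    moreover have x: "x \<in> carrier G" using m lincomb_closed[OF v_roots_closed] by simp
    ultimately have "B (v 0) x = 0" using kernel_symmetric[OF v_kernel, of 0 x] by simp
    with \<open>B x (v 0) = 0\<close> show ?thesis using x by (simp add: B_pow)
  qed
  ultimately show "orthogonal_sum G B (kernel G H c) E (generate G {v 0})"
    unfolding orthogonal_sum_def gen[symmetric] using sub disj gen generate_is_subgroup[of "{v 0}"] by auto
qed

text \<open>Subtract from \<open>d x\<close> its orthogonal projection to \<open>E\<close>.  The coefficients of the projection are
  obtained by applying \<open>d\<close> times the inverse Cartan matrix to the products of \<open>x\<close> with the roots, so they are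
  integers; as \<open>E\<close> lies in the kernel, the charge only gets multiplied by \<open>d\<close>, and orthogonality on one
  side gives it on the other.\<close>

lemma orthogonal_lift:
  assumes E: "E_root_lattice G B l E" "E \<subseteq> kernel G H c" and x: "x \<in> carrier G"
  shows "\<exists>x'\<in>carrier G. c x' = c x [^]\<^bsub>H\<^esub> int d \<and> (\<forall>z\<in>E. B x' z = 0 \<and> B z x' = 0)"
proof -
  obtain e where sub: "subgroup E G" and e: "Z_basis (G\<lparr>carrier := E\<rparr>) {1..l} e"
    and gram: "\<And>i j. i \<in> {1..l} \<Longrightarrow> j \<in> {1..l} \<Longrightarrow> B (e i) (e j) = cartan_E i j"
    using E(1) unfolding E_root_lattice_def by blast
  have eE: "e \<in> {1..l} \<rightarrow> E"
    using e by (simp add: Z_basis_def)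
  then have eG: "e \<in> {1..l} \<rightarrow> carrier G"
    using subgroup.subset[OF sub] by blast
  define n where "n i = (\<Sum>j\<in>{1..l}. M i j * B x (e j))" for i
  define r where "r = lincomb G {1..l} e (\<lambda>i. - n i)"
  define x' where "x' = x [^] int d \<otimes> r"
  have r: "r \<in> E" "r \<in> carrier G" "c r = \<one>\<^bsub>H\<^esub>"
  proof -
    show "r \<in> E"
      unfolding r_def by (rule lincomb_in_subgroup[OF sub _ eE]) simp
    then show "r \<in> carrier G" "c r = \<one>\<^bsub>H\<^esub>"
      using E(2) by (auto simp: kernel_def)
  qed
  have x': "x' \<in> carrier G" "c x' = c x [^]\<^bsub>H\<^esub> int d"
    using x r by (simp_all add: x'_def c.hom_int_pow)
  have ortho: "B x' (e k) = 0" if k: "k \<in> {1..l}" for k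
  proof -
    have ek: "e k \<in> carrier G" using eG k by blast
    have "(\<Sum>i\<in>{1..l}. n i * cartan_E i k)
        = (\<Sum>j\<in>{1..l}. B x (e j) * (\<Sum>i\<in>{1..l}. cartan_E k i * M i j))"
      unfolding n_def cartan_E_sym[of k] sum_distrib_right sum_distrib_left
      by (subst sum.swap) (simp add: ac_simps)
    also have "\<dots> = (\<Sum>j\<in>{1..l}. B x (e j) * (if k = j then int d else 0))"
      by (intro sum.cong refl arg_cong2[where f = "(*)"] cartan_inverse k)
    also have "\<dots> = B x (e k) * int d"
      using k by (simp add: if_distrib cong: if_cong)
    finally have n: "(\<Sum>i\<in>{1..l}. n i * cartan_E i k) = B x (e k) * int d" .
    have "B r (e k) = (\<Sum>i\<in>{1..l}. - n i * B (e i) (e k))"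
      unfolding r_def by (rule bilinear_form_lincomb_left[OF comm_group_axioms bilinear _ eG ek]) simp
    also have "\<dots> = (\<Sum>i\<in>{1..l}. - n i * cartan_E i k)"
      by (intro sum.cong refl arg_cong2[where f = "(*)"] gram k)
    also have "\<dots> = - (B x (e k) * int d)"
      using n by (simp add: sum_negf)
    finally show ?thesis
      unfolding x'_def using x r ek by (simp add: B_add B_pow)
  qed
  have "B x' z = 0 \<and> B z x' = 0" if "z \<in> E" for z
  proof -
    obtain m where "z = lincomb (G\<lparr>carrier := E\<rparr>) {1..l} e m"
      using comm_group.Z_basis_lincomb[OF comm_group_subgroup[OF sub] e, of z] \<open>z \<in> E\<close> by auto
    then have m: "z = lincomb G {1..l} e m"
      unfolding lincomb_subgroup[OF sub finite_atLeastAtMost eE] .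
    have "B x' z = (\<Sum>i\<in>{1..l}. m i * B x' (e i))"
      unfolding m by (rule bilinear_form_lincomb_right[OF comm_group_axioms bilinear _ eG x'(1)]) simp
    also have "\<dots> = 0" by (intro sum.neutral) (simp add: ortho)
    finally show ?thesis
      using kernel_symmetric[of z x'] E(2) that x'(1) by auto
  qed
  with x' show ?thesis by blast
qed

end

section \<open>Extension of scalars to the rationals\<close>

lemma rat_extension_pow:
  assumes G: "group G" and ext: "rat_extension G sc \<iota>" and x: "x \<in> carrier G"
  shows "\<iota> (x [^]\<^bsub>G\<^esub> (k::int)) = sc (of_int k) (\<iota> x)"
proof -
  interpret group G by fact
  interpret vector_space sc using ext by (simp add: rat_extension_def)
  have add: "\<iota> (x \<otimes>\<^bsub>G\<^esub> y) = \<iota> x + \<iota> y" if "x \<in> carrier G" "y \<in> carrier G" for x y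
    using ext that by (simp add: rat_extension_def)
  have one: "\<iota> \<one>\<^bsub>G\<^esub> = 0" using add[of "\<one>\<^bsub>G\<^esub>" "\<one>\<^bsub>G\<^esub>"] by simp
  have inv: "\<iota> (inv\<^bsub>G\<^esub> y) = - \<iota> y" if "y \<in> carrier G" for y
  proof -
    have "\<iota> (inv\<^bsub>G\<^esub> y) + \<iota> y = \<iota> (inv\<^bsub>G\<^esub> y \<otimes>\<^bsub>G\<^esub> y)"
      using that by (simp only: add inv_closed)
    then show ?thesis using that by (simp only: l_inv one eq_neg_iff_add_eq_0)
  qed
  have nat: "\<iota> (x [^]\<^bsub>G\<^esub> (n::nat)) = sc (of_nat n) (\<iota> x)" for n
  proof (induction n)
    case (Suc n)
    have "\<iota> (x [^]\<^bsub>G\<^esub> Suc n) = \<iota> (x [^]\<^bsub>G\<^esub> n) + \<iota> x"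
      unfolding nat_pow_Suc by (rule add) (simp_all add: x)
    also have "\<dots> = sc (of_nat n + 1) (\<iota> x)"
      unfolding Suc scale_left_distrib by (simp only: scale_one)
    finally show ?case by (simp only: of_nat_Suc add.commute[of 1])
  next
    case 0
    show ?case by (simp only: nat_pow_0 one of_nat_0 scale_zero_left)
  qed
  show ?thesis
  proof (cases k rule: int_cases2)
    case (nonneg n)
    then show ?thesis by (simp only: int_pow_int nat of_int_of_nat_eq)
  next
    case (nonpos n)
    have "\<iota> (x [^]\<^bsub>G\<^esub> k) = - sc (of_nat n) (\<iota> x)"
      unfolding nonpos int_pow_neg[OF x] int_pow_int inv[OF nat_pow_closed[OF x]] nat ..
    then show ?thesis
      by (simp only: nonpos of_int_minus of_int_of_nat_eq scale_minus_left)
  qed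
qed

lemma rat_common_denominator:
  fixes s t :: rat
  obtains m n k :: int where "k > 0" "s = of_int m / of_int k" "t = of_int n / of_int k"
proof -
  obtain p q where s: "s = of_int p / of_int q" "q > 0"
    using quotient_of_div[of s] quotient_of_denom_pos[of s] by (metis prod.collapse)
  obtain p' q' where t: "t = of_int p' / of_int q'" "q' > 0"
    using quotient_of_div[of t] quotient_of_denom_pos[of t] by (metis prod.collapse)
  show thesis
    by (rule that[of "q * q'" "p * q'" "p' * q"]) (use s t in \<open>simp_all add: field_simps\<close>)
qed

context adapted_lattice
begin

text \<open>A linear relation between \<open>\<iota> a\<close> and \<open>\<iota> b\<close> over the rationals becomes integral after clearing
  denominators, and then holds in \<open>H\<close> up to torsion; a further multiple of it is a relation between \<open>a\<close> and \<open>b\<close>.\<close>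

lemma rational_basis:
  assumes ext: "rat_extension H sc \<iota>"
  shows "\<exists>s t. w = sc s (\<iota> a) + sc t (\<iota> b)"
    and "sc s (\<iota> a) + sc t (\<iota> b) = 0 \<Longrightarrow> s = 0 \<and> t = 0"
proof -
  interpret vector_space sc using ext by (simp add: rat_extension_def)
  have coord: "\<iota> (a [^]\<^bsub>H\<^esub> (m::int) \<otimes>\<^bsub>H\<^esub> b [^]\<^bsub>H\<^esub> (n::int)) = sc (of_int m) (\<iota> a) + sc (of_int n) (\<iota> b)" for m n
  proof -
    have "\<iota> (a [^]\<^bsub>H\<^esub> m \<otimes>\<^bsub>H\<^esub> b [^]\<^bsub>H\<^esub> n) = \<iota> (a [^]\<^bsub>H\<^esub> m) + \<iota> (b [^]\<^bsub>H\<^esub> n)"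
      using ext by (simp add: rat_extension_def)
    then show ?thesis
      by (simp add: rat_extension_pow[OF H.is_group ext])
  qed
  show "\<exists>s t. w = sc s (\<iota> a) + sc t (\<iota> b)"
  proof -
    obtain h and k :: nat where h: "h \<in> carrier H" "k > 0" "sc (of_nat k) w = \<iota> h"
      using ext unfolding rat_extension_def by blast
    obtain m n where "h = a [^]\<^bsub>H\<^esub> (m::int) \<otimes>\<^bsub>H\<^esub> b [^]\<^bsub>H\<^esub> (n::int)"
      using h(1) by (rule ab_coords)
    with h coord have "sc (of_nat k) w = sc (of_int m) (\<iota> a) + sc (of_int n) (\<iota> b)" by simp
    then have "sc (1 / of_nat k) (sc (of_nat k) w) = sc (1 / of_nat k) (sc (of_int m) (\<iota> a) + sc (of_int n) (\<iota> b))"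
      by simp
    then have "w = sc (of_int m / of_nat k) (\<iota> a) + sc (of_int n / of_nat k) (\<iota> b)"
      using h(2) by (simp add: scale_right_distrib)
    then show ?thesis by blast
  qed
  assume st: "sc s (\<iota> a) + sc t (\<iota> b) = 0"
  obtain m n k :: int where k: "k > 0" and s: "s = of_int m / of_int k" and t: "t = of_int n / of_int k"
    by (rule rat_common_denominator)
  have "sc (of_int k) (sc s (\<iota> a) + sc t (\<iota> b)) = 0" unfolding st by simp
  then have "\<iota> (a [^]\<^bsub>H\<^esub> m \<otimes>\<^bsub>H\<^esub> b [^]\<^bsub>H\<^esub> n) = 0"
    unfolding coord using k by (simp add: s t scale_right_distrib)
  then obtain j :: nat where j: "j > 0" "(a [^]\<^bsub>H\<^esub> m \<otimes>\<^bsub>H\<^esub> b [^]\<^bsub>H\<^esub> n) [^]\<^bsub>H\<^esub> j = \<one>\<^bsub>H\<^esub>"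
    using ext ab_closed unfolding rat_extension_def by blast
  then have "a [^]\<^bsub>H\<^esub> (m * int j) \<otimes>\<^bsub>H\<^esub> b [^]\<^bsub>H\<^esub> (n * int j) = \<one>\<^bsub>H\<^esub>"
    by (simp add: H.int_pow_distrib H.int_pow_pow flip: int_pow_int)
  then show "s = 0 \<and> t = 0"
    using ab_independent j(1) s t by fastforce
qed

text \<open>The plane \<open>V\<close> is spanned by orthogonal lifts of \<open>d a\<close> and \<open>d b\<close>.  Since their charges form a basis of
  the target, the charge maps \<open>V\<close> isomorphically onto everything, and every vector differs from
  the element of \<open>V\<close> with the same charge by an element of the kernel.\<close>

lemma rational_splitting:
  assumes E: "E_root_lattice G B l E" "E \<subseteq> kernel G H c"
    and extG: "rat_extension G scG \<iota>G" and extH: "rat_extension H scH \<iota>H"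
    and hom: "extends_hom G scG \<iota>G scH \<iota>H c cQ" and form: "extends_form G scG \<iota>G B BQ"
  shows "\<exists>V. direct_sum_decomp scG {x. cQ x = 0} V \<and> bij_betw cQ V (range cQ) \<and>
           (\<forall>x\<in>V. \<forall>e\<in>module.span scG (\<iota>G ` E). BQ x e = 0 \<and> BQ e x = 0)"
proof -
  interpret K: vector_space scG using extG by (simp add: rat_extension_def)
  interpret L: vector_space scH using extH by (simp add: rat_extension_def)
  interpret cQ: Vector_Spaces.linear scG scH cQ using hom by (simp add: extends_hom_def)
  obtain x where x: "x \<in> carrier G" "c x = a [^]\<^bsub>H\<^esub> int d" "\<forall>z\<in>E. B x z = 0 \<and> B z x = 0"
    using orthogonal_lift[OF E, of "v (l + 1)"] unfolding charge_lifts by auto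
  obtain y where y: "y \<in> carrier G" "c y = b [^]\<^bsub>H\<^esub> int d" "\<forall>z\<in>E. B y z = 0 \<and> B z y = 0"
    using orthogonal_lift[OF E, of "v (l + 2)"] unfolding charge_lifts by auto
  define f where "f s t = scG s (\<iota>G x) + scG t (\<iota>G y)" for s t
  define V where "V = {f s t | s t. True}"
  have cf: "cQ (f s t) = scH (s * of_nat d) (\<iota>H a) + scH (t * of_nat d) (\<iota>H b)" for s t
  proof -
    have "cQ (\<iota>G x) = scH (of_nat d) (\<iota>H a)" "cQ (\<iota>G y) = scH (of_nat d) (\<iota>H b)"
      using hom x y rat_extension_pow[OF H.is_group extH, of _ "int d"] by (simp_all add: extends_hom_def)
    then show ?thesis by (simp add: f_def cQ.add cQ.scale)
  qed
  have f_zero: "s = 0 \<and> t = 0" if "cQ (f s t) = 0" for s t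
    using rational_basis(2)[OF extH that[unfolded cf]] d_pos by simp
  have subV: "K.subspace V"
  proof (rule K.subspaceI)
    have "0 = f 0 0" by (simp add: f_def)
    then show "0 \<in> V" unfolding V_def by blast
  next
    fix u w assume "u \<in> V" "w \<in> V"
    then obtain s t s' t' where "u = f s t" "w = f s' t'" unfolding V_def by blast
    then have "u + w = f (s + s') (t + t')"
      by (simp add: f_def K.scale_left_distrib)
    then show "u + w \<in> V" unfolding V_def by blast
  next
    fix r u assume "u \<in> V"
    then obtain s t where "u = f s t" unfolding V_def by blast
    then have "scG r u = f (r * s) (r * t)"
      by (simp add: f_def K.scale_right_distrib)
    then show "scG r u \<in> V" unfolding V_def by blast
  qed
  have subker: "K.subspace {u. cQ u = 0}"
    by (rule K.subspaceI) (simp_all add: cQ.add cQ.scale cQ.zero)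
  have inter: "u = 0" if "u \<in> V" "cQ u = 0" for u
    using that f_zero unfolding V_def f_def by force
  have onto: "\<exists>u'\<in>V. cQ u' = w" for w
  proof -
    obtain s t where "w = scH s (\<iota>H a) + scH t (\<iota>H b)" using rational_basis(1)[OF extH] by blast
    then have "cQ (f (s / of_nat d) (t / of_nat d)) = w"
      using d_pos by (simp add: cf)
    then show ?thesis unfolding V_def by blast
  qed
  have "direct_sum_decomp scG {u. cQ u = 0} V"
    unfolding direct_sum_decomp_def
  proof (intro conjI subker subV)
    show "{u. cQ u = 0} \<inter> V = {0}"
      using inter K.subspace_0[OF subV] by (auto simp: cQ.zero)
    have "\<exists>u' w'. w = u' + w' \<and> cQ u' = 0 \<and> w' \<in> V" for w
    proof -
      obtain u where u: "u \<in> V" "cQ u = cQ w" using onto by blast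
      then have "w = (w - u) + u \<and> cQ (w - u) = 0 \<and> u \<in> V"
        by (simp add: cQ.diff)
      then show ?thesis by blast
    qed
    then show "{u + w | u w. u \<in> {u. cQ u = 0} \<and> w \<in> V} = UNIV"
      by blast
  qed
  moreover have "bij_betw cQ V (range cQ)"
    unfolding bij_betw_def
  proof
    show "inj_on cQ V"
    proof (rule inj_onI)
      fix u w assume "u \<in> V" "w \<in> V" "cQ u = cQ w"
      then have "u - w = 0"
        by (intro inter K.subspace_diff[OF subV]) (simp_all add: cQ.diff)
      then show "u = w" by simp
    qed
    have "range cQ \<subseteq> cQ ` V"
      using onto by (metis image_eqI subsetI)
    then show "cQ ` V = range cQ"
      by (rule equalityI[OF image_mono[OF subset_UNIV]])
  qed
  moreover have "BQ u e = 0 \<and> BQ e u = 0" if u: "u \<in> V" and e: "e \<in> K.span (\<iota>G ` E)" for u e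
  proof -
    have linB: "Vector_Spaces.linear scG (*) (BQ w)" "Vector_Spaces.linear scG (*) (\<lambda>u. BQ u w)" for w
      using form unfolding extends_form_def by blast+
    have BQ: "BQ (\<iota>G x) (\<iota>G y) = of_int (B x y)" if "x \<in> carrier G" "y \<in> carrier G" for x y
      using form that unfolding extends_form_def by blast
    interpret Bl: Vector_Spaces.linear scG "(*)" "BQ u" by (rule linB)
    interpret Br: Vector_Spaces.linear scG "(*)" "\<lambda>w. BQ w u" by (rule linB)
    obtain s t where st: "u = f s t" using u unfolding V_def by blast
    show ?thesis
      using e
    proof (induction rule: K.span_induct)
      case base
      show ?case
        by (rule K.subspaceI) (simp_all add: Bl.add Bl.scale Bl.zero Br.add Br.scale Br.zero)
    next
      case (step e)
      then obtain z where z: "z \<in> E" "e = \<iota>G z" by blast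
      then have zG: "z \<in> carrier G" using E(2) by (auto simp: kernel_def)
      interpret Bzl: Vector_Spaces.linear scG "(*)" "BQ (\<iota>G z)" by (rule linB)
      interpret Bzr: Vector_Spaces.linear scG "(*)" "\<lambda>w. BQ w (\<iota>G z)" by (rule linB)
      show ?case
        using BQ zG x(1) y(1) bspec[OF x(3) z(1)] bspec[OF y(3) z(1)] z(2)
        by (simp add: st f_def Bzl.add Bzl.scale Bzr.add Bzr.scale)
    qed
  qed
  ultimately show ?thesis by blast
qed

end

section \<open>Adapted bases for the thimbles\<close>

definition dot :: "int list \<Rightarrow> int list \<Rightarrow> int" where
  "dot xs ys = sum_list (map2 (*) xs ys)"

text \<open>This is the matrix product of \<open>A\<close> with the transpose of \<open>B\<close>.  Pairing rows with rows lets the matrix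
  identities below be evaluated by running through each list once, instead of looking up entries.\<close>

definition row_products :: "int list list \<Rightarrow> int list list \<Rightarrow> int list list" where
  "row_products A B = map (\<lambda>r. map (dot r) B) A"

definition columns :: "nat \<Rightarrow> int list list \<Rightarrow> int list list" where
  "columns n A = map (\<lambda>k. map (\<lambda>r. r ! k) A) [0..<n]"

definition table :: "nat \<Rightarrow> nat \<Rightarrow> (nat \<Rightarrow> nat \<Rightarrow> int) \<Rightarrow> int list list" where
  "table m n f = map (\<lambda>i. map (f i) [0..<n]) [0..<m]"

lemma row_products_nth:
  assumes "i < length A" "j < length B" "length (A ! i) = n" "length (B ! j) = n"
  shows "row_products A B ! i ! j = (\<Sum>k<n. A ! i ! k * B ! j ! k)"
  using assms by (simp add: row_products_def dot_def sum_list_sum_nth atLeast0LessThan)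

lemma row_products_length:
  "length (row_products A B) = length A" "i < length A \<Longrightarrow> length (row_products A B ! i) = length B"
  by (simp_all add: row_products_def)

lemma table_nth: "i < m \<Longrightarrow> j < n \<Longrightarrow> table m n f ! i ! j = f i j"
  by (simp add: table_def)

lemma table_length: "length (table m n f) = m" "i < m \<Longrightarrow> length (table m n f ! i) = n"
  by (simp_all add: table_def)

lemma columns_nth: "i < n \<Longrightarrow> k < length A \<Longrightarrow> columns n A ! i ! k = A ! k ! i"
  by (simp add: columns_def)

lemma columns_length: "length (columns n A) = n" "i < n \<Longrightarrow> length (columns n A ! i) = length A"
  by (simp_all add: columns_def)

text \<open>The Gram matrix of the Seifert form in the thimbles, computed from the coordinates of their boundaries.\<close>

definition seifert_entry :: "nat \<Rightarrow> nat \<Rightarrow> nat \<Rightarrow> int" where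
  "seifert_entry d i j =
    (if i < j then snd (boundary_coeffs d ! i) * fst (boundary_coeffs d ! j)
        - fst (boundary_coeffs d ! i) * snd (boundary_coeffs d ! j)
     else if i = j then 1 else 0)"

text \<open>The coordinates of the adapted basis with respect to the thimbles.  The first row is the point-like class:
  up to sign it is the only primitive vector with trivial charge that is orthogonal to the roots.  The next
  \<open>9 - d\<close> rows are the simple roots.  Many combinations of two or three thimbles with cancelling boundaries
  have square \<open>2\<close>, for instance all differences of thimbles with the same boundary, and a Dynkin diagram of
  type \<open>E\<close> can be selected among them.  The last two rows
  are thimbles with boundaries \<open>a\<close> and \<open>b\<close>.\<close>

definition adapted_rows :: "nat \<Rightarrow> int list list" where
  "adapted_rows d =
    (if d = 1 then
     [[1, 0, 1, -1, 0, -1, -1, 0, -1, 1, 0],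
      [0, 0, 1, 0, -1, 0, 0, 0, 0, 0, 0],
      [-1, 0, 0, 1, 1, 0, 0, 0, 0, 0, 0],
      [0, 0, 0, -1, 0, 1, 0, 0, 0, 0, 0],
      [0, 1, 0, 0, 0, -1, 0, 0, 0, 0, 0],
      [1, -1, 0, 0, 0, 0, -1, 0, 0, 0, 0],
      [0, 0, 0, 0, 0, 0, 1, 0, 0, 0, -1],
      [0, 0, 0, 0, 0, 0, 0, 0, -1, 0, 1],
      [0, 0, 0, 0, 0, 0, 0, -1, 0, 1, 0],
      [0, 1, 0, 0, 0, 0, 0, 0, 0, 0, 0],
      [0, 0, 1, 0, 0, 0, 0, 0, 0, 0, 0]]
     else if d = 2 then
     [[1, 0, 1, -1, -1, 0, -1, -1, 1, 0],
      [0, 0, 0, 0, 0, 0, -1, 1, 0, 0],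
      [-1, 0, 0, 0, 0, 0, 0, 0, 1, 1],
      [0, 0, 0, 0, 0, 0, 1, 0, 0, -1],
      [0, 1, 0, 0, 0, 0, 0, 0, -1, 0],
      [0, -1, 0, 1, 0, 0, 0, 0, 0, 0],
      [0, 0, 0, -1, 1, 0, 0, 0, 0, 0],
      [0, 0, -1, 1, 0, -1, 0, 0, 0, 0],
      [0, 1, 0, 0, 0, 0, 0, 0, 0, 0],
      [0, 0, 1, 0, 0, 0, 0, 0, 0, 0]]
     else
     [[1, 1, -1, 0, -1, -1, 0, -1, 1],
      [0, 0, 1, 0, -1, 0, 0, 0, 0],
      [1, 0, -1, -1, 0, 0, 0, 0, 0],
      [0, -1, 0, 1, 0, 0, 0, 0, 0],
      [0, 1, 0, 0, 0, -1, 0, 0, 0],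
      [0, 0, 0, 0, 0, 1, 0, -1, 0],
      [0, 0, 0, 0, 0, 0, -1, 0, 1],
      [0, 0, 1, 0, 0, 0, 0, 0, 0],
      [0, 1, 0, 0, 0, 0, 0, 0, 0]])"

text \<open>The transpose of the inverse of the previous matrix, that is the dual basis.\<close>

definition adapted_dual_rows :: "nat \<Rightarrow> int list list" where
  "adapted_dual_rows d =
    (if d = 1 then
     [[0, 0, 0, 0, 0, 0, 0, 1, 0, 1, 0],
      [-1, 0, 0, 0, -1, 0, -1, -1, -1, -1, -1],
      [-1, 0, 0, 0, 0, 0, -1, -1, -1, -1, -1],
      [-1, 0, 0, -1, 0, 0, -1, -2, -1, -2, -1],
      [-1, 0, 0, -1, 0, -1, -1, -3, -1, -3, -1],
      [0, 0, 0, 0, 0, 0, -1, -2, -1, -2, -1],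
      [0, 0, 0, 0, 0, 0, 0, -1, -1, -1, -1],
      [0, 0, 0, 0, 0, 0, 0, -1, -1, -1, 0],
      [0, 0, 0, 0, 0, 0, 0, -1, 0, 0, 0],
      [1, 1, 0, 1, 0, 1, 0, 1, 0, 1, 0],
      [1, 0, 1, 0, 1, 0, 1, 0, 1, 0, 1]]
     else if d = 2 then
     [[-1, 0, 0, 0, 0, 0, -1, -1, 0, -1],
      [-1, 0, 0, 0, 0, 0, -1, 0, 0, -1],
      [-2, 0, 0, 0, 0, 0, -1, -1, 0, -1],
      [-2, 0, 0, 0, 0, 0, -1, -1, 0, -2],
      [-3, 0, 0, 0, 0, 0, -2, -2, -1, -2],
      [-2, 0, 0, 1, 1, 1, -2, -2, 0, -2],
      [-1, 0, 0, 0, 1, 0, -1, -1, 0, -1],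
      [0, 0, 0, 0, 0, -1, 0, 0, 0, 0],
      [1, 1, 0, 1, 1, 1, 0, 0, 1, 0],
      [1, 0, 1, 0, 0, -1, 1, 1, 0, 1]]
     else
     [[0, 0, 0, 0, 0, 0, 1, 0, 1],
      [0, 0, 0, 0, -1, 0, -1, 0, -1],
      [1, 0, 0, 0, 0, 0, -1, 0, -1],
      [1, 0, 0, 1, 0, 0, -1, 0, -1],
      [0, 0, 0, 0, 0, -1, -2, -1, -2],
      [0, 0, 0, 0, 0, 0, -1, -1, -1],
      [0, 0, 0, 0, 0, 0, -1, 0, 0],
      [1, 0, 1, 0, 1, 0, 1, 0, 1],
      [1, 1, 0, 1, 0, 1, 0, 1, 0]])"

text \<open>This is \<open>d\<close> times the inverse of the Cartan matrix of type \<open>E\<close> and rank \<open>9 - d\<close>, whose determinant is \<open>d\<close>.\<close>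

definition cartan_adjugate :: "nat \<Rightarrow> int list list" where
  "cartan_adjugate d =
    (if d = 1 then
     [[4, 5, 7, 10, 8, 6, 4, 2],
      [5, 8, 10, 15, 12, 9, 6, 3],
      [7, 10, 14, 20, 16, 12, 8, 4],
      [10, 15, 20, 30, 24, 18, 12, 6],
      [8, 12, 16, 24, 20, 15, 10, 5],
      [6, 9, 12, 18, 15, 12, 8, 4],
      [4, 6, 8, 12, 10, 8, 6, 3],
      [2, 3, 4, 6, 5, 4, 3, 2]]
     else if d = 2 then
     [[4, 4, 6, 8, 6, 4, 2],
      [4, 7, 8, 12, 9, 6, 3],
      [6, 8, 12, 16, 12, 8, 4],
      [8, 12, 16, 24, 18, 12, 6],
      [6, 9, 12, 18, 15, 10, 5],
      [4, 6, 8, 12, 10, 8, 4],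
      [2, 3, 4, 6, 5, 4, 3]]
     else
     [[4, 3, 5, 6, 4, 2],
      [3, 6, 6, 9, 6, 3],
      [5, 6, 10, 12, 8, 4],
      [6, 9, 12, 18, 12, 6],
      [4, 6, 8, 12, 10, 5],
      [2, 3, 4, 6, 5, 4]])"


lemmas table_evaluation = row_products_def table_def columns_def dot_def upt_rec[of _ "numeral _"]
  adapted_rows_def adapted_dual_rows_def cartan_adjugate_def boundary_coeffs_def
  seifert_entry_def cartan_E_def E_edge_def doubleton_eq_iff

lemma adapted_lengths:
  "\<forall>d\<in>{1, 2, 3}. length (adapted_rows d) = 12 - d \<and> (\<forall>r\<in>set (adapted_rows d). length r = 12 - d)"
  "\<forall>d\<in>{1, 2, 3}. length (adapted_dual_rows d) = 12 - d \<and> (\<forall>r\<in>set (adapted_dual_rows d). length r = 12 - d)"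
  "\<forall>d\<in>{1, 2, 3}. length (cartan_adjugate d) = 9 - d \<and> (\<forall>r\<in>set (cartan_adjugate d). length r = 9 - d)"
  "\<forall>d\<in>{1, 2, 3}. length (boundary_coeffs d) = 12 - d"
  by (simp_all add: table_evaluation)

lemma adapted_rows_dual:
  "\<forall>d\<in>{1, 2, 3}. row_products (adapted_rows d) (adapted_dual_rows d)
     = table (12 - d) (12 - d) (\<lambda>i j. if i = j then 1 else 0)"
  by (simp add: table_evaluation del: map_eq_conv)

lemma adapted_columns_dual:
  "\<forall>d\<in>{1, 2, 3}. row_products (columns (12 - d) (adapted_dual_rows d)) (columns (12 - d) (adapted_rows d))
     = table (12 - d) (12 - d) (\<lambda>i j. if i = j then 1 else 0)"
  by (simp add: table_evaluation del: map_eq_conv)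

lemma adapted_rows_charges:
  "\<forall>d\<in>{1, 2, 3}. row_products (adapted_rows d) [map fst (boundary_coeffs d), map snd (boundary_coeffs d)]
     = table (12 - d) 2 (\<lambda>i j. if i = 10 - d + j then 1 else 0)"
  by (simp add: table_evaluation del: map_eq_conv)

lemma cartan_adjugate_inverse:
  "\<forall>d\<in>{1, 2, 3}. row_products (table (9 - d) (9 - d) (\<lambda>i j. cartan_E (Suc i) (Suc j))) (cartan_adjugate d)
     = table (9 - d) (9 - d) (\<lambda>i j. if i = j then int d else 0)"
  by (simp add: table_evaluation del: map_eq_conv)

lemma adapted_rows_gram:
  "\<forall>d\<in>{1, 2, 3}. row_products (take (10 - d) (adapted_rows d)) 
       (row_products (take (10 - d) (adapted_rows d)) (table (12 - d) (12 - d) (seifert_entry d)))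
     = table (10 - d) (10 - d) (\<lambda>i j. if i = 0 \<or> j = 0 then 0 else cartan_E i j)"
  by (simp add: table_evaluation del: map_eq_conv)
context
  fixes d :: nat
  assumes d: "d \<in> {1, 2, 3}"
begin

lemma adapted_length:
  "length (adapted_rows d) = 12 - d" "i < 12 - d \<Longrightarrow> length (adapted_rows d ! i) = 12 - d"
  "length (adapted_dual_rows d) = 12 - d" "i < 12 - d \<Longrightarrow> length (adapted_dual_rows d ! i) = 12 - d"
  "length (cartan_adjugate d) = 9 - d" "i < 9 - d \<Longrightarrow> length (cartan_adjugate d ! i) = 9 - d"
  "length (boundary_coeffs d) = 12 - d"
  using bspec[OF adapted_lengths(1) d] bspec[OF adapted_lengths(2) d]
    bspec[OF adapted_lengths(3) d] bspec[OF adapted_lengths(4) d] by simp_all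

lemma adapted_inverse_right:
  assumes "i < 12 - d" "j < 12 - d"
  shows "(\<Sum>k<12 - d. adapted_rows d ! i ! k * adapted_dual_rows d ! j ! k) = (if i = j then 1 else 0)"
proof -
  have "(\<Sum>k<12 - d. adapted_rows d ! i ! k * adapted_dual_rows d ! j ! k)
      = row_products (adapted_rows d) (adapted_dual_rows d) ! i ! j"
    using assms by (subst row_products_nth) (simp_all add: adapted_length)
  also have "\<dots> = (if i = j then 1 else 0)"
    using adapted_rows_dual d assms by (simp only: table_nth)
  finally show ?thesis .
qed

lemma adapted_inverse_left:
  assumes "i < 12 - d" "j < 12 - d"
  shows "(\<Sum>k<12 - d. adapted_dual_rows d ! k ! i * adapted_rows d ! k ! j) = (if i = j then 1 else 0)"
proof -
  have "(\<Sum>k<12 - d. adapted_dual_rows d ! k ! i * adapted_rows d ! k ! j)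
      = row_products (columns (12 - d) (adapted_dual_rows d)) (columns (12 - d) (adapted_rows d)) ! i ! j"
    using assms by (subst row_products_nth) (auto simp: adapted_length columns_length columns_nth intro!: sum.cong)
  also have "\<dots> = (if i = j then 1 else 0)"
    using adapted_columns_dual d assms by (simp only: table_nth)
  finally show ?thesis .
qed

lemma adapted_charges:
  assumes "i < 12 - d"
  shows "(\<Sum>k<12 - d. adapted_rows d ! i ! k * fst (boundary_coeffs d ! k)) = (if i = 10 - d then 1 else 0)"
    and "(\<Sum>k<12 - d. adapted_rows d ! i ! k * snd (boundary_coeffs d ! k)) = (if i = 11 - d then 1 else 0)"
proof -
  let ?C = "[map fst (boundary_coeffs d), map snd (boundary_coeffs d)]"
  have entry: "(\<Sum>k<12 - d. adapted_rows d ! i ! k * ?C ! j ! k) = (if i = 10 - d + j then 1 else 0)"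
    if j: "j < 2" for j
  proof -
    have "length (?C ! j) = 12 - d" using j by (auto simp: adapted_length less_2_cases_iff)
    then have "(\<Sum>k<12 - d. adapted_rows d ! i ! k * ?C ! j ! k) = row_products (adapted_rows d) ?C ! i ! j"
      using assms j by (subst row_products_nth) (simp_all add: adapted_length)
    also have "\<dots> = (if i = 10 - d + j then 1 else 0)"
      using adapted_rows_charges d assms j by (simp only: table_nth)
    finally show ?thesis .
  qed
  have "10 - d + 1 = 11 - d" using d by auto
  then show "(\<Sum>k<12 - d. adapted_rows d ! i ! k * fst (boundary_coeffs d ! k)) = (if i = 10 - d then 1 else 0)"
    "(\<Sum>k<12 - d. adapted_rows d ! i ! k * snd (boundary_coeffs d ! k)) = (if i = 11 - d then 1 else 0)"
    using entry[of 0] entry[of 1] by (simp_all add: adapted_length)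
qed

lemma cartan_adjugate:
  assumes "i \<in> {1..9 - d}" "k \<in> {1..9 - d}"
  shows "(\<Sum>j\<in>{1..9 - d}. cartan_E i j * cartan_adjugate d ! (k - 1) ! (j - 1)) = (if i = k then int d else 0)"
proof -
  let ?C = "table (9 - d) (9 - d) (\<lambda>i j. cartan_E (Suc i) (Suc j))"
  have less: "i - 1 < 9 - d" "k - 1 < 9 - d" and ik: "i - 1 = k - 1 \<longleftrightarrow> i = k" and i: "Suc (i - 1) = i"
    using assms by auto
  have "(\<Sum>j\<in>{1..9 - d}. cartan_E i j * cartan_adjugate d ! (k - 1) ! (j - 1))
      = (\<Sum>j<9 - d. ?C ! (i - 1) ! j * cartan_adjugate d ! (k - 1) ! j)"
    using less i by (simp add: sum.atLeast1_atMost_eq table_nth)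
  also have "\<dots> = row_products ?C (cartan_adjugate d) ! (i - 1) ! (k - 1)"
    using less by (subst row_products_nth) (simp_all add: adapted_length table_length)
  also have "\<dots> = (if i = k then int d else 0)"
    using cartan_adjugate_inverse d less ik by (simp only: table_nth)
  finally show ?thesis .
qed

lemma adapted_gram:
  assumes "i < 10 - d" "j < 10 - d"
  shows "(\<Sum>k<12 - d. adapted_rows d ! i ! k * (\<Sum>m<12 - d. adapted_rows d ! j ! m * seifert_entry d k m))
    = (if i = 0 \<or> j = 0 then 0 else cartan_E i j)"
proof -
  let ?R = "take (10 - d) (adapted_rows d)" and ?S = "table (12 - d) (12 - d) (seifert_entry d)"
  have R: "length ?R = 10 - d" "?R ! i = adapted_rows d ! i" "?R ! j = adapted_rows d ! j"
    using assms d by (auto simp: adapted_length)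
  have ij: "i < 12 - d" "j < 12 - d" using assms by auto
  have "(\<Sum>m<12 - d. adapted_rows d ! j ! m * seifert_entry d k m) = row_products ?R ?S ! j ! k"
    if "k < 12 - d" for k
    using that assms ij R
    by (subst row_products_nth) (auto simp: adapted_length table_length table_nth intro!: sum.cong)
  then have "(\<Sum>k<12 - d. adapted_rows d ! i ! k * (\<Sum>m<12 - d. adapted_rows d ! j ! m * seifert_entry d k m))
      = (\<Sum>k<12 - d. ?R ! i ! k * row_products ?R ?S ! j ! k)"
    unfolding R by (intro sum.cong) simp_all
  also have "\<dots> = row_products ?R (row_products ?R ?S) ! i ! j"
    using assms ij R by (subst row_products_nth) (simp_all add: adapted_length table_length row_products_length)
  also have "\<dots> = (if i = 0 \<or> j = 0 then 0 else cartan_E i j)"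
    using adapted_rows_gram d assms by (simp only: table_nth)
  finally show ?thesis .
qed

end

text \<open>The thimbles enter only through the coordinates of their boundaries, which determine the Gram matrix of the form
  and the charges of the new basis elements.  That the antisymmetrised form is the intersection pairing of
  the charges need only be compared on pairs of thimbles, where it is the definition of the Seifert
  pairing.\<close>

lemma thimbles_adapted_lattice:
  fixes G :: "('a, 'm) monoid_scheme" and H :: "('b, 'n) monoid_scheme"
  assumes d: "d \<in> {1, 2, 3}" and G: "comm_group G" and H: "comm_group H" and c: "c \<in> hom G H"
    and D: "Z_basis G {..<12 - d} D" and ab: "Z_basis H {..<2::nat} ((!) [a, b])"
    and isect: "intersection_pairing H a b Q"
    and charges: "\<And>i. i < 12 - d \<Longrightarrow> c (D i) =
           (a [^]\<^bsub>H\<^esub> fst (boundary_coeffs d ! i)) \<otimes>\<^bsub>H\<^esub> (b [^]\<^bsub>H\<^esub> snd (boundary_coeffs d ! i))"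
    and seifert: "seifert_pairing G (12 - d) D c Q B"
  shows "adapted_lattice G H c B Q (\<lambda>i. lincomb G {..<12 - d} D (\<lambda>k. adapted_rows d ! i ! k))
           a b (9 - d) d (\<lambda>j k. cartan_adjugate d ! (k - 1) ! (j - 1))"
proof -
  interpret G: comm_group G by fact
  interpret H: comm_group H by fact
  interpret c: group_hom G H c using c by unfold_locales
  define v where "v = (\<lambda>i. lincomb G {..<12 - d} D (\<lambda>k. adapted_rows d ! i ! k))"
  have DG: "D \<in> {..<12 - d} \<rightarrow> carrier G" using D by (rule G.Z_basis_closed)
  have D_closed: "D i \<in> carrier G" if "i < 12 - d" for i using DG that by blast
  have ab_closed: "a \<in> carrier H" "b \<in> carrier H"
    using H.Z_basis_closed[OF ab] by (auto simp: Pi_iff dest: bspec[of _ _ 0] bspec[of _ _ 1])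
  have v_closed: "v i \<in> carrier G" for i
    unfolding v_def using DG by (rule G.lincomb_closed)
  have bil: "bilinear_form G B" using seifert by (simp add: seifert_pairing_def)
  have bilQ: "bilinear_form H Q" and altQ: "\<forall>x\<in>carrier H. Q x x = 0"
    using isect by (auto simp: intersection_pairing_def)
  have B_D: "B (D i) (D j) = (if i < j then Q (c (D i)) (c (D j)) else if i = j then 1 else 0)"
    if "i < 12 - d" "j < 12 - d" for i j
    using seifert that by (simp add: seifert_pairing_def)
  have B_entry: "B (D i) (D j) = seifert_entry d i j" if "i < 12 - d" "j < 12 - d" for i j
    using that by (simp add: B_D seifert_entry_def charges intersection_pairing_coords[OF H isect ab_closed])
  have antisym: "B x y - B y x = Q (c x) (c y)" if "x \<in> carrier G" "y \<in> carrier G" for x y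
  proof (rule bilinear_form_eqI[OF G finite_lessThan D _ _ _ that])
    show "bilinear_form G (\<lambda>x y. B x y - B y x)"
      using bil by (simp add: bilinear_form_def)
    show "bilinear_form G (\<lambda>x y. Q (c x) (c y))"
      using bilQ by (simp add: bilinear_form_def)
    fix i j assume "i \<in> {..<12 - d}" "j \<in> {..<12 - d}"
    then have ij: "i < 12 - d" "j < 12 - d" by auto
    then have "Q (c (D i)) (c (D j)) = - Q (c (D j)) (c (D i))"
      by (intro alternating_antisym[OF H bilQ altQ] c.hom_closed D_closed)
    moreover have "Q (c (D i)) (c (D i)) = 0"
      using altQ c.hom_closed[OF D_closed[OF ij(1)]] by blast
    ultimately show "B (D i) (D j) - B (D j) (D i) = Q (c (D i)) (c (D j))"
      using ij by (cases i j rule: linorder_cases) (simp_all add: B_D)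
  qed
  have gram: "B (v i) (v j) = (if i = 0 \<or> j = 0 then 0 else cartan_E i j)" if "i < 10 - d" "j < 10 - d" for i j
  proof -
    have "B (v i) (v j) = (\<Sum>k<12 - d. adapted_rows d ! i ! k * B (D k) (v j))"
      unfolding v_def[THEN fun_cong, of i]
      by (rule bilinear_form_lincomb_left[OF G bil finite_lessThan DG v_closed])
    also have "\<dots> = (\<Sum>k<12 - d. adapted_rows d ! i ! k * (\<Sum>m<12 - d. adapted_rows d ! j ! m * B (D k) (D m)))"
      unfolding v_def
      by (intro sum.cong refl arg_cong2[where f = "(*)"] bilinear_form_lincomb_right[OF G bil finite_lessThan DG] D_closed)
        auto
    also have "\<dots> = (\<Sum>k<12 - d. adapted_rows d ! i ! k * (\<Sum>m<12 - d. adapted_rows d ! j ! m * seifert_entry d k m))"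
      by (intro sum.cong refl arg_cong2[where f = "(*)"] B_entry) auto
    also have "\<dots> = (if i = 0 \<or> j = 0 then 0 else cartan_E i j)"
      by (rule adapted_gram[OF d that])
    finally show ?thesis .
  qed
  have cv: "c (v i) = a [^]\<^bsub>H\<^esub> (if i = 10 - d then 1 else 0 :: int) \<otimes>\<^bsub>H\<^esub> b [^]\<^bsub>H\<^esub> (if i = 11 - d then 1 else 0 :: int)"
    if i: "i < 12 - d" for i
  proof -
    let ?m = "\<lambda>k. adapted_rows d ! i ! k"
    have "c (v i) = lincomb H {..<12 - d} (\<lambda>k. c (D k)) ?m"
      unfolding v_def by (rule G.hom_lincomb[OF H c finite_lessThan DG])
    also have "\<dots> = (\<Otimes>\<^bsub>H\<^esub>k\<in>{..<12 - d}. a [^]\<^bsub>H\<^esub> (?m k * fst (boundary_coeffs d ! k)) \<otimes>\<^bsub>H\<^esub>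
          b [^]\<^bsub>H\<^esub> (?m k * snd (boundary_coeffs d ! k)))"
      using ab_closed
      by (intro H.finprod_cong')
        (simp_all add: charges H.int_pow_distrib H.int_pow_pow mult.commute)
    also have "\<dots> = lincomb H {..<12 - d} (\<lambda>_. a) (\<lambda>k. ?m k * fst (boundary_coeffs d ! k)) \<otimes>\<^bsub>H\<^esub>
          lincomb H {..<12 - d} (\<lambda>_. b) (\<lambda>k. ?m k * snd (boundary_coeffs d ! k))"
      using ab_closed by (intro H.finprod_multf) auto
    also have "\<dots> = a [^]\<^bsub>H\<^esub> (\<Sum>k<12 - d. ?m k * fst (boundary_coeffs d ! k)) \<otimes>\<^bsub>H\<^esub>
          b [^]\<^bsub>H\<^esub> (\<Sum>k<12 - d. ?m k * snd (boundary_coeffs d ! k))"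
      using ab_closed by (simp add: H.lincomb_const)
    also have "(\<Sum>k<12 - d. ?m k * fst (boundary_coeffs d ! k)) = (if i = 10 - d then 1 else 0)"
      by (rule adapted_charges(1)[OF d i])
    also have "(\<Sum>k<12 - d. ?m k * snd (boundary_coeffs d ! k)) = (if i = 11 - d then 1 else 0)"
      by (rule adapted_charges(2)[OF d i])
    finally show ?thesis .
  qed
  have l: "9 - d + 3 = 12 - d" "9 - d + 1 = 10 - d" "9 - d + 2 = 11 - d" using d by auto
  show ?thesis
    unfolding v_def[symmetric]
  proof (unfold_locales)
    show "Z_basis G {..<9 - d + 3} v"
      unfolding v_def l
    proof (rule G.Z_basis_change[OF finite_lessThan D, where Q = "\<lambda>i j. adapted_dual_rows d ! j ! i"])
      fix i j assume "i \<in> {..<12 - d}" "j \<in> {..<12 - d}"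
      then have ij: "i < 12 - d" "j < 12 - d" by auto
      show "(\<Sum>k<12 - d. adapted_rows d ! i ! k * adapted_dual_rows d ! j ! k) = (if i = j then 1 else 0)"
        by (rule adapted_inverse_right[OF d ij])
      show "(\<Sum>k<12 - d. adapted_dual_rows d ! k ! i * adapted_rows d ! k ! j) = (if i = j then 1 else 0)"
        by (rule adapted_inverse_left[OF d ij])
    qed
    show "c (v i) = \<one>\<^bsub>H\<^esub>" if "i \<le> 9 - d" for i
    proof -
      have "i < 12 - d" "i \<noteq> 10 - d" "i \<noteq> 11 - d" using d that by auto
      then show ?thesis by (simp add: cv)
    qed
    show "c (v (9 - d + 1)) = a" "c (v (9 - d + 2)) = b"
      unfolding l using d ab_closed by (auto simp: cv)
    show "B (v i) (v j) = cartan_E i j" if "i \<in> {1..9 - d}" "j \<in> {1..9 - d}" for i j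
      using that by (subst gram) auto
    show "B (v 0) (v i) = 0" if "i \<le> 9 - d" for i
      using that d by (subst gram) auto
    show "0 < d" using d by auto
    show "(\<Sum>j\<in>{1..9 - d}. cartan_E i j * cartan_adjugate d ! (k - 1) ! (j - 1)) = (if i = k then int d else 0)"
      if "i \<in> {1..9 - d}" "k \<in> {1..9 - d}" for i k
      by (rule cartan_adjugate[OF d that])
  qed (fact c ab bil isect antisym)+
qed

section \<open>Kernel and image of the asymptotic charge\<close>

theorem proposition1p7:
  fixes d l :: nat and \<epsilon> :: complex
    and D :: "nat \<Rightarrow> (complex \<times> line) chain set"
    and a b p :: "(complex \<times> line) chain set"
    and isect sft :: "(complex \<times> line) chain set \<Rightarrow> (complex \<times> line) chain set \<Rightarrow> int"
    and scaleK :: "rat \<Rightarrow> 'v \<Rightarrow> 'v::ab_group_add" and \<iota>K :: "(complex \<times> line) chain set \<Rightarrow> 'v"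
    and scaleH :: "rat \<Rightarrow> 'w \<Rightarrow> 'w::ab_group_add" and \<iota>H :: "(complex \<times> line) chain set \<Rightarrow> 'w"
    and cQ :: "'v \<Rightarrow> 'w" and sftQ :: "'v \<Rightarrow> 'v \<Rightarrow> rat"
  assumes "d \<in> {1, 2, 3}" and "l = 9 - d" and "generic_perturbation d \<epsilon>"
    and "thimble_system d \<epsilon> D"
    and "Z_basis (K0 d \<epsilon>) {..<l + 3} D"
    and "Z_basis (H1 d \<epsilon>) {..<2::nat} ((!) [a, b])"
    and "intersection_pairing (H1 d \<epsilon>) a b isect"
    and "\<And>i m n. i < l + 3 \<Longrightarrow> boundary_coeffs d ! i = (m, n) \<Longrightarrow>
           charge d \<epsilon> (D i) = (a [^]\<^bsub>H1 d \<epsilon>\<^esub> m) \<otimes>\<^bsub>H1 d \<epsilon>\<^esub> (b [^]\<^bsub>H1 d \<epsilon>\<^esub> n)"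
    and "seifert_pairing (K0 d \<epsilon>) (l + 3) D (charge d \<epsilon>) isect sft"
    and "point_like (K0 d \<epsilon>) sft p"
    and "rat_extension (K0 d \<epsilon>) scaleK \<iota>K"
    and "rat_extension (H1 d \<epsilon>) scaleH \<iota>H"
    and "extends_hom (K0 d \<epsilon>) scaleK \<iota>K scaleH \<iota>H (charge d \<epsilon>) cQ"
    and "extends_form (K0 d \<epsilon>) scaleK \<iota>K sft sftQ"
  shows "(\<exists>E. E_root_lattice (K0 d \<epsilon>) sft l E \<and>
              orthogonal_sum (K0 d \<epsilon>) sft (kernel (K0 d \<epsilon>) (H1 d \<epsilon>) (charge d \<epsilon>))
                E (generate (K0 d \<epsilon>) {p})) \<and>
         (\<forall>E. E_root_lattice (K0 d \<epsilon>) sft l E \<and>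
              orthogonal_sum (K0 d \<epsilon>) sft (kernel (K0 d \<epsilon>) (H1 d \<epsilon>) (charge d \<epsilon>))
                E (generate (K0 d \<epsilon>) {p}) \<longrightarrow>
              (\<exists>V. direct_sum_decomp scaleK {v. cQ v = 0} V \<and>
                   bij_betw cQ V (range cQ) \<and>
                   (\<forall>v\<in>V. \<forall>e\<in>module.span scaleK (\<iota>K ` E). sftQ v e = 0 \<and> sftQ e v = 0)))"
proof -
  let ?G = "K0 d \<epsilon>" and ?H = "H1 d \<epsilon>" and ?c = "charge d \<epsilon>"
  have d: "d \<in> {1, 2, 3}" and l: "l = 9 - d" by fact+
  have n: "l + 3 = 12 - d" using d l by auto
  have G: "comm_group ?G" and H: "comm_group ?H" by (simp_all add: K0_def H1_def)
  have c: "?c \<in> hom ?G ?H"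
    using hom_boundary_hom[of 2 "total_space d \<epsilon>" "ref_fibre d \<epsilon>"] by (simp add: charge_def K0_def H1_def)
  interpret adapted_lattice ?G ?H ?c sft isect
    "\<lambda>i. lincomb ?G {..<12 - d} D (\<lambda>k. adapted_rows d ! i ! k)" a b l d
    "\<lambda>j k. cartan_adjugate d ! (k - 1) ! (j - 1)"
    unfolding l
  proof (rule thimbles_adapted_lattice[OF d G H c])
    show "Z_basis ?G {..<12 - d} D" "seifert_pairing ?G (12 - d) D ?c isect sft"
      using \<open>Z_basis ?G {..<l + 3} D\<close> \<open>seifert_pairing ?G (l + 3) D ?c isect sft\<close> by (simp_all only: n)
    show "?c (D i) = a [^]\<^bsub>?H\<^esub> fst (boundary_coeffs d ! i) \<otimes>\<^bsub>?H\<^esub> b [^]\<^bsub>?H\<^esub> snd (boundary_coeffs d ! i)"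
      if "i < 12 - d" for i
      using that by (intro assms(8)) (simp_all add: n)
  qed fact+
  have p: "generate ?G {p} = generate ?G {lincomb ?G {..<12 - d} D (\<lambda>k. adapted_rows d ! 0 ! k)}"
    using \<open>point_like ?G sft p\<close> by (rule generate_point)
  show ?thesis
  proof (intro conjI allI impI)
    show "\<exists>E. E_root_lattice ?G sft l E \<and> orthogonal_sum ?G sft (kernel ?G ?H ?c) E (generate ?G {p})"
      unfolding p using kernel_decomposition by blast
  next
    fix E
    assume E: "E_root_lattice ?G sft l E \<and> orthogonal_sum ?G sft (kernel ?G ?H ?c) E (generate ?G {p})"
    have "E \<subseteq> kernel ?G ?H ?c"
    proof
      fix x assume "x \<in> E"
      have "subgroup E ?G" and F: "subgroup (generate ?G {p}) ?G"
        and sum: "kernel ?G ?H ?c = E <#>\<^bsub>?G\<^esub> generate ?G {p}"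
        using E by (auto simp: orthogonal_sum_def)
      have "x \<otimes>\<^bsub>?G\<^esub> \<one>\<^bsub>?G\<^esub> \<in> kernel ?G ?H ?c"
        unfolding sum set_mult_def using \<open>x \<in> E\<close> subgroup.one_closed[OF F] by blast
      then show "x \<in> kernel ?G ?H ?c"
        using subgroup.mem_carrier[OF \<open>subgroup E ?G\<close> \<open>x \<in> E\<close>] by simp
    qed
    with E show "\<exists>V. direct_sum_decomp scaleK {v. cQ v = 0} V \<and> bij_betw cQ V (range cQ) \<and>
        (\<forall>v\<in>V. \<forall>e\<in>module.span scaleK (\<iota>K ` E). sftQ v e = 0 \<and> sftQ e v = 0)"
      by (intro rational_splitting[where \<iota>G = \<iota>K and \<iota>H = \<iota>H and scH = scaleH]) (use assms in auto)
  qed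
qed

end
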